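(* Let $\mathcal{B}$ be a stable base. Then there is a valid $\mathcal{B}$-library $\rho$ such that $\neg_\rho\neg_\rho\mathcal{T}$ is false. Furthermore, the law $A\ \vdash_\rho\ \neg_\rho\neg_\rho A$ (for all algorithmic statements $A$) does not hold for all $\mathcal{B}$-libraries $\rho$. In particular, no stable base contains Rule $P_{12}$, the rule implementing the diagram $A\,/\,\neg_\rho\neg_\rho A$.
   Context: Framework. Algorithms are recursive algorithms in a fixed standard model. A datum is anything that can be input to an algorithm; data include natural numbers and algorithms, and every finite list of data is a datum. Every algorithm accepts exactly one input datum and either does not halt or halts with exactly one output datum. Every datum has a positive integer size, only finitely many data have a given size, and the size of a list is strictly greater than the sum of the sizes of its items. A process is a pair (algorithm, input). Every halting process has a positive integer runtime; if a process runs subprocesses in its execution, its runtime is strictly greater than the sum of the runtimes of the halting subprocesses. An algorithmic statement is a datum $[\alpha,u,v]$ with $\alpha$ an algorithm, asserting that $\alpha$ with input $u$ halts with output $v$; it is true if this is so and false otherwise. To say that an algorithmic statement holds is to say that it is true. $\mathcal{T}$ denotes the true statement $[\mathrm{identity},0,0]$ and $\mathcal{F}$ the false statement $[\mathrm{identity},0,1]$, where $\mathrm{identity}$ outputs a copy of its input. Rules and libraries. An algorithmic sequence is an algorithm $\rho$ that halts on every positive integer $n$; its output is written $\rho_n$. A rule is an algorithm which, on every input $[H,\rho,m]$ with $H$ a finite list of algorithmic statements (hypothesis list), $\rho$ an algorithmic sequence (nominal library) and $m$ a positive integer (resource integer), halts and outputs a list of algorithmic statements (conclusion list) having $H$ as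 an initial sublist, and which is monotone: if $m'\ge m$ and every item of $H$ is an item of $H'$, then every item of the output on $[H,\rho,m]$ is an item of the output on $[H',\rho,m']$. A library is an algorithmic sequence $\rho$ such that every $\rho_n$ is a rule (not necessarily distinct); the $\rho_n$ are the rules contained in $\rho$. A rule is $\rho$-valid if for every list $H$ of true statements and every $m$, its output on $[H,\rho,m]$ consists only of true statements. A library $\rho$ is valid if all its rules are $\rho$-valid. Bases. A base is a set $\mathcal{B}$ of rules that is finite or is the set of terms of a library. A $\mathcal{B}$-library is a library containing all rules of $\mathcal{B}$. A $\mathcal{B}$-library $\rho$ is valid outside $\mathcal{B}$ if every rule in $\rho$ which is not in $\mathcal{B}$ is $\rho$-valid. A base $\mathcal{B}$ is stable if every $\mathcal{B}$-library that is valid outside $\mathcal{B}$ is valid. Deduction. Fix a recursive bijection $f:\mathbb{N}_+\to\mathbb{N}_+\times\mathbb{N}_+$. The algorithm $\mathrm{deduce}$, on input $[\Gamma,\rho,B]$ ($\Gamma$ a list of algorithmic statements, $\rho$ a library, $B$ an algorithmic statement), computes lists $H_0=\Gamma,H_1,H_2,\dots$, where for $i>0$ with $f(i)=(k,m)$ the list $H_i$ is the output of $\rho_k$ on $[H_{i-1},\rho,m]$; after computing each $H_i$ it checks whether $B$ is on $H_i$, outputs $1$ if so, and otherwise continues. The algorithmic statement $[\mathrm{deduce},[\Gamma,\rho,B],1]$ is denoted $\Gamma\vdash_\rho B$ (the notation is used for any datum $\rho$), and $A_1,\dots,A_n\vdash_\rho B$ means this with $\Gamma=[A_1,\dots,A_n]$.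 $A\Rightarrow_\rho B$ denotes $A\vdash_\rho B$, and $\neg_\rho A$ denotes $A\Rightarrow_\rho\mathcal{F}$. Rule diagrams. A rule implementing "$X_1,\dots,X_r\,/\,Y$" is the algorithm which on input $[H,\rho,m]$ outputs $H$ with $Y$ appended for every instance (letters ranging over algorithmic statements) whose premises $X_1,\dots,X_r$ are all on $H$; the $\rho$ in $\neg_\rho$ is the nominal library in the input. *)

theory Defs
  imports Main "HOL-Library.Nat_Bijection"
begin

section \<open>The model of computation\<close>

text \<open>
  The fixed standard model is a functional language in the style of Backus' FP: programs are
  built from basic operations on data by constants, list construction, composition,
  conditionals and loops, together with a universal program \<open>Run\<close> that executes
  an algorithm given as data. Algorithms are themselves data, and they can be taken apart and
  put together by \<open>Explode\<close> and \<open>Implode\<close>, so that every effective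
  manipulation of data (syntax of algorithms included) is programmable.
\<close>

datatype oper = Ident | Head | Tail | Succ | Pred | Equal | Kind | Explode | Implode

datatype datum = Num nat | Lst "datum list" | Alg algo
  and algo =
    Basic oper
  | Const datum
  | Prepend algo algo
  | Comp algo algo
  | Cond algo algo algo
  | While algo algo
  | Run

primrec datum_size :: "datum \<Rightarrow> nat" and algo_size :: "algo \<Rightarrow> nat" where
  "datum_size (Num n) = Suc n"
| "datum_size (Lst ds) = Suc (sum_list (map datum_size ds))"
| "datum_size (Alg a) = Suc (algo_size a)"
| "algo_size (Basic b) = 1"
| "algo_size (Const d) = Suc (datum_size d)"
| "algo_size (Prepend a b) = Suc (algo_size a + algo_size b)"
| "algo_size (Comp a b) = Suc (algo_size a + algo_size b)"
| "algo_size (Cond a b c) = Suc (algo_size a + algo_size b + algo_size c)"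
| "algo_size (While a b) = Suc (algo_size a + algo_size b)"
| "algo_size Run = 1"

fun oper_code :: "oper \<Rightarrow> nat" where
  "oper_code Ident = 0"
| "oper_code Head = 1"
| "oper_code Tail = 2"
| "oper_code Succ = 3"
| "oper_code Pred = 4"
| "oper_code Equal = 5"
| "oper_code Kind = 6"
| "oper_code Explode = 7"
| "oper_code Implode = 8"

fun explode :: "algo \<Rightarrow> datum" where
  "explode (Basic b) = Lst [Num 0, Num (oper_code b)]"
| "explode (Const d) = Lst [Num 1, d]"
| "explode (Prepend a b) = Lst [Num 2, Alg a, Alg b]"
| "explode (Comp a b) = Lst [Num 3, Alg a, Alg b]"
| "explode (Cond a b c) = Lst [Num 4, Alg a, Alg b, Alg c]"
| "explode (While a b) = Lst [Num 5, Alg a, Alg b]"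
| "explode Run = Lst [Num 6]"

text \<open>
  Basic operations are total; an operation leaves an argument of the wrong shape unchanged.
\<close>

fun basic :: "oper \<Rightarrow> datum \<Rightarrow> datum" where
  "basic Ident d = d"
| "basic Head d = (case d of Lst (x # xs) \<Rightarrow> x | _ \<Rightarrow> d)"
| "basic Tail d = (case d of Lst (x # xs) \<Rightarrow> Lst xs | _ \<Rightarrow> d)"
| "basic Succ d = (case d of Num n \<Rightarrow> Num (Suc n) | _ \<Rightarrow> d)"
| "basic Pred d = (case d of Num n \<Rightarrow> Num (n - 1) | _ \<Rightarrow> d)"
| "basic Equal d = (case d of Lst [x, y] \<Rightarrow> Num (if x = y then 1 else 0) | _ \<Rightarrow> d)"
| "basic Kind d = (case d of Num _ \<Rightarrow> Num 0 | Lst _ \<Rightarrow> Num 1 | Alg _ \<Rightarrow> Num 2)"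
| "basic Explode d = (case d of Alg a \<Rightarrow> explode a | _ \<Rightarrow> d)"
| "basic Implode d = (if d \<in> range explode then Alg (the_inv explode d) else d)"

text \<open>
  \<open>exec a u v t\<close>: algorithm \<open>a\<close> with input \<open>u\<close> halts with
  output \<open>v\<close> and runtime \<open>t\<close>. The processes in the premises of a clause
  are the subprocesses that are run, and \<open>Num 0\<close> is the truth value ``no''. A
  process for which no clause applies (e.g. \<open>Run\<close> on an ill-formed input) does not
  halt.
\<close>

inductive exec :: "algo \<Rightarrow> datum \<Rightarrow> datum \<Rightarrow> nat \<Rightarrow> bool" where
  Basic: "exec (Basic b) u (basic b u) 1"
| Const: "exec (Const d) u d 1"
| Prepend: "\<lbrakk>exec a u v s; exec b u (Lst vs) t\<rbrakk>
    \<Longrightarrow> exec (Prepend a b) u (Lst (v # vs)) (Suc (s + t))"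
| Comp: "\<lbrakk>exec b u v s; exec a v w t\<rbrakk> \<Longrightarrow> exec (Comp a b) u w (Suc (s + t))"
| Cond_yes: "\<lbrakk>exec p u c s; c \<noteq> Num 0; exec a u v t\<rbrakk>
    \<Longrightarrow> exec (Cond p a b) u v (Suc (s + t))"
| Cond_no: "\<lbrakk>exec p u (Num 0) s; exec b u v t\<rbrakk>
    \<Longrightarrow> exec (Cond p a b) u v (Suc (s + t))"
| While_no: "exec p u (Num 0) s \<Longrightarrow> exec (While p a) u u (Suc s)"
| While_yes: "\<lbrakk>exec p u c r; c \<noteq> Num 0; exec a u v s; exec (While p a) v w t\<rbrakk>
    \<Longrightarrow> exec (While p a) u w (Suc (r + s + t))"
| Run: "exec a u v t \<Longrightarrow> exec Run (Lst [Alg a, u]) v (Suc t)"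

definition outputs :: "algo \<Rightarrow> datum \<Rightarrow> datum \<Rightarrow> bool" where
  "outputs a u v \<longleftrightarrow> (\<exists>t. exec a u v t)"


section \<open>Algorithmic statements\<close>

definition algorithmic_statement :: "datum \<Rightarrow> bool" where
  "algorithmic_statement A \<longleftrightarrow> (\<exists>a u v. A = Lst [Alg a, u, v])"

definition holds :: "datum \<Rightarrow> bool" where
  "holds A \<longleftrightarrow> (\<exists>a u v. A = Lst [Alg a, u, v] \<and> outputs a u v)"

definition fails :: "datum \<Rightarrow> bool" where
  "fails A \<longleftrightarrow> algorithmic_statement A \<and> \<not> holds A"

definition verum :: datum where
  "verum = Lst [Alg (Basic Ident), Num 0, Num 0]"

definition falsum :: datum where
  "falsum = Lst [Alg (Basic Ident), Num 0, Num 1]"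


section \<open>Rules, libraries, bases\<close>

definition algorithmic_sequence :: "algo \<Rightarrow> bool" where
  "algorithmic_sequence \<rho> \<longleftrightarrow> (\<forall>n\<ge>1. \<exists>v. outputs \<rho> (Num n) v)"

definition hypothesis_list :: "datum list \<Rightarrow> bool" where
  "hypothesis_list H \<longleftrightarrow> (\<forall>A\<in>set H. algorithmic_statement A)"

abbreviation rule_input :: "datum list \<Rightarrow> algo \<Rightarrow> nat \<Rightarrow> datum" where
  "rule_input H \<rho> m \<equiv> Lst [Lst H, Alg \<rho>, Num m]"

definition rule :: "algo \<Rightarrow> bool" where
  "rule R \<longleftrightarrow>
     (\<forall>H \<rho> m. hypothesis_list H \<and> algorithmic_sequence \<rho> \<and> m \<ge> 1 \<longrightarrow>
        (\<exists>C. outputs R (rule_input H \<rho> m) (Lst (H @ C)) \<and> hypothesis_list (H @ C))) \<and>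
     (\<forall>H H' \<rho> m m' C C'.
        hypothesis_list H \<and> hypothesis_list H' \<and> algorithmic_sequence \<rho> \<and>
        m \<ge> 1 \<and> m' \<ge> m \<and> set H \<subseteq> set H' \<and>
        outputs R (rule_input H \<rho> m) (Lst C) \<and> outputs R (rule_input H' \<rho> m') (Lst C') \<longrightarrow>
        set C \<subseteq> set C')"

definition library :: "algo \<Rightarrow> bool" where
  "library \<rho> \<longleftrightarrow> (\<forall>n\<ge>1. \<exists>R. outputs \<rho> (Num n) (Alg R) \<and> rule R)"

definition rules_of :: "algo \<Rightarrow> algo set" where
  "rules_of \<rho> = {R. \<exists>n\<ge>1. outputs \<rho> (Num n) (Alg R)}"

definition valid_rule :: "algo \<Rightarrow> algo \<Rightarrow> bool" where
  "valid_rule \<rho> R \<longleftrightarrow>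
     (\<forall>H m C. (\<forall>A\<in>set H. holds A) \<and> m \<ge> 1 \<and> outputs R (rule_input H \<rho> m) (Lst C) \<longrightarrow>
        (\<forall>A\<in>set C. holds A))"

definition valid_library :: "algo \<Rightarrow> bool" where
  "valid_library \<rho> \<longleftrightarrow> library \<rho> \<and> (\<forall>R\<in>rules_of \<rho>. valid_rule \<rho> R)"

definition base :: "algo set \<Rightarrow> bool" where
  "base \<B> \<longleftrightarrow> (\<forall>R\<in>\<B>. rule R) \<and> (finite \<B> \<or> (\<exists>\<rho>. library \<rho> \<and> \<B> = rules_of \<rho>))"

definition base_library :: "algo set \<Rightarrow> algo \<Rightarrow> bool" where
  "base_library \<B> \<rho> \<longleftrightarrow> library \<rho> \<and> \<B> \<subseteq> rules_of \<rho>"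

definition valid_outside :: "algo set \<Rightarrow> algo \<Rightarrow> bool" where
  "valid_outside \<B> \<rho> \<longleftrightarrow> (\<forall>R\<in>rules_of \<rho> - \<B>. valid_rule \<rho> R)"

definition stable_base :: "algo set \<Rightarrow> bool" where
  "stable_base \<B> \<longleftrightarrow>
     base \<B> \<and> (\<forall>\<rho>. base_library \<B> \<rho> \<and> valid_outside \<B> \<rho> \<longrightarrow> valid_library \<rho>)"


section \<open>Deduction\<close>

text \<open>
  \<open>\<phi>\<close> computes a bijection from the positive integers to the pairs of positive
  integers.
\<close>

definition pair_enumeration :: "algo \<Rightarrow> bool" where
  "pair_enumeration \<phi> \<longleftrightarrow>
     (\<exists>f. bij_betw f {1..} ({1..} \<times> {1..}) \<and>
          (\<forall>i\<ge>1. outputs \<phi> (Num i) (Lst [Num (fst (f i)), Num (snd (f i))])))"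

definition tuple :: "algo list \<Rightarrow> algo" where
  "tuple as = foldr Prepend as (Const (Lst []))"

primrec item :: "nat \<Rightarrow> algo" where
  "item 0 = Basic Head"
| "item (Suc k) = Comp (item k) (Basic Tail)"

definition test_equal :: "algo \<Rightarrow> algo \<Rightarrow> algo" where
  "test_equal a b = Comp (Basic Equal) (tuple [a, b])"

definition negate :: "algo \<Rightarrow> algo" where
  "negate p = Cond p (Const (Num 0)) (Const (Num 1))"

text \<open>Input \<open>[x, xs]\<close>: outputs 1 if \<open>x\<close> is on \<open>xs\<close>, otherwise 0.\<close>

definition member_prog :: algo where
  "member_prog =
     (let empty = test_equal (item 1) (Const (Lst []));
          found = test_equal (item 0) (Comp (Basic Head) (item 1))
      in Comp (negate empty)
           (While (Cond empty (Const (Num 0)) (negate found))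
              (tuple [item 0, Comp (Basic Tail) (item 1)])))"

text \<open>
  The loop of \<open>deduce \<phi>\<close>, on input \<open>[\<Gamma>, \<rho>, B]\<close>, has
  the states \<open>[H\<^sub>i, i, \<rho>, B]\<close> for \<open>i = 0, 1, 2, \<dots>\<close> and
  is left as soon as \<open>B\<close> is on \<open>H\<^sub>i\<close> (\<open>i = 0\<close> included); in a pass, \<open>pair\<close>
  is the pair \<open>[k, m]\<close> that \<open>\<phi>\<close> assigns to the next index.
\<close>

definition deduce :: "algo \<Rightarrow> algo" where
  "deduce \<phi> =
     (let init = tuple [item 0, Const (Num 0), item 1, item 2];
          continue = negate (Comp member_prog (tuple [item 3, item 0]));
          next = Comp (Basic Succ) (item 1);
          pair = Comp \<phi> next;
          rule_k = Comp Run (tuple [item 2, Comp (item 0) pair]);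
          apply_rule = Comp Run (tuple [rule_k, tuple [item 0, item 2, Comp (item 1) pair]])
      in Comp (Const (Num 1))
           (Comp (While continue (tuple [apply_rule, next, item 2, item 3])) init))"

definition entails :: "algo \<Rightarrow> datum \<Rightarrow> datum list \<Rightarrow> datum \<Rightarrow> datum" where
  "entails \<phi> \<rho> \<Gamma> B = Lst [Alg (deduce \<phi>), Lst [Lst \<Gamma>, \<rho>, B], Num 1]"

definition implies :: "algo \<Rightarrow> datum \<Rightarrow> datum \<Rightarrow> datum \<Rightarrow> datum" where
  "implies \<phi> \<rho> A B = entails \<phi> \<rho> [A] B"

definition neg :: "algo \<Rightarrow> datum \<Rightarrow> datum \<Rightarrow> datum" where
  "neg \<phi> \<rho> A = implies \<phi> \<rho> A falsum"


section \<open>Rule diagrams\<close>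

text \<open>
  A diagram is given by its instances \<open>(premises, conclusion)\<close>, depending on the
  nominal library. The order and multiplicity in which the conclusions are appended is
  irrelevant.
\<close>

definition implements_diagram :: "algo \<Rightarrow> (algo \<Rightarrow> (datum list \<times> datum) set) \<Rightarrow> bool" where
  "implements_diagram P D \<longleftrightarrow>
     (\<forall>H \<rho> m. hypothesis_list H \<and> algorithmic_sequence \<rho> \<and> m \<ge> 1 \<longrightarrow>
        (\<exists>C. outputs P (rule_input H \<rho> m) (Lst (H @ C)) \<and>
             set C = {Y. \<exists>Xs. (Xs, Y) \<in> D \<rho> \<and> set Xs \<subseteq> set H}))"

definition double_neg_diagram :: "algo \<Rightarrow> algo \<Rightarrow> (datum list \<times> datum) set" where
  "double_neg_diagram \<phi> \<rho> =
     {([A], neg \<phi> (Alg \<rho>) (neg \<phi> (Alg \<rho>) A)) | A. algorithmic_statement A}"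


section \<open>Adequacy of the model\<close>

lemma datum_size_pos: "datum_size d > 0"
  by (cases d) auto

lemma datum_size_list: "sum_list (map datum_size ds) < datum_size (Lst ds)"
  by simp

lemma algo_size_pos: "algo_size a > 0"
  by (cases a) auto

lemma finite_size_le: "finite {d. datum_size d \<le> n} \<and> finite {a. algo_size a \<le> n}"
proof (induction n)
  case 0
  show ?case
    by (simp add: datum_size_pos[THEN gr_implies_not0] algo_size_pos[THEN gr_implies_not0])
next
  case (Suc n)
  let ?D = "{d. datum_size d \<le> n}" and ?A = "{a. algo_size a \<le> n}"
  have fD: "finite ?D" and fA: "finite ?A" using Suc by auto
  have len: "length ds \<le> sum_list (map datum_size ds)" for ds
  proof (induction ds)
    case (Cons d ds)
    then show ?case using datum_size_pos[of d] by simp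
  qed simp
  have mem: "d \<in> set ds \<Longrightarrow> datum_size d \<le> sum_list (map datum_size ds)" for d ds
    by (simp add: member_le_sum_list)
  have D: "{d. datum_size d \<le> Suc n} \<subseteq>
      Num ` {..n} \<union> Lst ` {ds. set ds \<subseteq> ?D \<and> length ds \<le> n} \<union> Alg ` ?A"
  proof
    fix d assume "d \<in> {d. datum_size d \<le> Suc n}"
    then show "d \<in> Num ` {..n} \<union> Lst ` {ds. set ds \<subseteq> ?D \<and> length ds \<le> n} \<union> Alg ` ?A"
    proof (cases d)
      case (Lst ds)
      then have "sum_list (map datum_size ds) \<le> n" using \<open>d \<in> _\<close> by simp
      then have "set ds \<subseteq> ?D" "length ds \<le> n"
        using len[of ds] mem[of _ ds] by (auto intro: le_trans)
      then show ?thesis using Lst by blast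
    qed (use \<open>d \<in> _\<close> in auto)
  qed
  have finops: "finite (UNIV :: oper set)"
  proof -
    have "(UNIV :: oper set) =
      {Ident, Head, Tail, Succ, Pred, Equal, Kind, Explode, Implode}"
      by (auto intro: oper.exhaust)
    then show ?thesis using finite.emptyI finite_insert by metis
  qed
  have A: "{a. algo_size a \<le> Suc n} \<subseteq>
      range Basic \<union> Const ` ?D \<union> (\<lambda>(a, b). Prepend a b) ` (?A \<times> ?A)
      \<union> (\<lambda>(a, b). Comp a b) ` (?A \<times> ?A) \<union> (\<lambda>(a, b, c). Cond a b c) ` (?A \<times> ?A \<times> ?A)
      \<union> (\<lambda>(a, b). While a b) ` (?A \<times> ?A) \<union> {Run}" (is "_ \<subseteq> ?R")
  proof
    fix a assume "a \<in> {a. algo_size a \<le> Suc n}"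
    then show "a \<in> ?R"
      by (cases a) (auto simp: image_iff)
  qed
  have "finite {d. datum_size d \<le> Suc n}"
    by (rule finite_subset[OF D]) (use fD fA in \<open>auto intro: finite_lists_length_le\<close>)
  moreover have "finite {a. algo_size a \<le> Suc n}"
    by (rule finite_subset[OF A]) (use fD fA finops in auto)
  ultimately show ?case by simp
qed

lemma finite_datum_size: "finite {d. datum_size d = n}"
  by (rule finite_subset[of _ "{d. datum_size d \<le> n}"]) (use finite_size_le in auto)

lemma inj_explode: "inj explode"
proof (rule injI)
  fix a b assume "explode a = explode b"
  moreover have "oper_code x = oper_code y \<Longrightarrow> x = y" for x y
    by (cases x; cases y) auto
  ultimately show "a = b" by (cases a; cases b) auto
qed

lemma implode_explode: "basic Implode (explode a) = Alg a"
  by (simp add: the_inv_f_f inj_explode)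

inductive_cases exec_BasicE: "exec (Basic b) u v t"
inductive_cases exec_ConstE: "exec (Const d) u v t"
inductive_cases exec_PrependE: "exec (Prepend a b) u v t"
inductive_cases exec_CompE: "exec (Comp a b) u v t"
inductive_cases exec_CondE: "exec (Cond p a b) u v t"
inductive_cases exec_WhileE: "exec (While p a) u v t"
inductive_cases exec_RunE: "exec Run u v t"

lemma exec_deterministic: "exec a u v t \<Longrightarrow> exec a u v' t' \<Longrightarrow> v' = v \<and> t' = t"
proof (induction arbitrary: v' t' rule: exec.induct)
  case (Basic b u)
  then show ?case by (auto elim: exec_BasicE)
next
  case (Const d u)
  then show ?case by (auto elim: exec_ConstE)
next
  case (Prepend a u v s b vs t)
  from Prepend.prems show ?case by (auto elim!: exec_PrependE dest!: Prepend.IH)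
next
  case (Comp b u v s a w t)
  from Comp.prems show ?case by (auto elim!: exec_CompE dest!: Comp.IH)
next
  case (Cond_yes p u c s a v t b)
  from Cond_yes.prems Cond_yes.hyps show ?case
    by (auto elim!: exec_CondE dest!: Cond_yes.IH)
next
  case (Cond_no p u s b v t a)
  from Cond_no.prems show ?case by (auto elim!: exec_CondE dest!: Cond_no.IH)
next
  case (While_no p u s a)
  from While_no.prems show ?case by (rule exec_WhileE) (auto dest!: While_no.IH)
next
  case (While_yes p u c r a v s w t)
  from While_yes.prems While_yes.hyps show ?case
    by - (erule exec_WhileE; auto dest!: While_yes.IH)
next
  case (Run a u v t)
  from Run.prems show ?case by (auto elim!: exec_RunE dest!: Run.IH)
qed

lemma exec_time_pos: "exec a u v t \<Longrightarrow> t > 0"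
  by (induction rule: exec.induct) auto

lemma outputs_deterministic: "outputs a u v \<Longrightarrow> outputs a u v' \<Longrightarrow> v' = v"
  unfolding outputs_def using exec_deterministic by blast

lemma outputs_Basic [simp]: "outputs (Basic b) u v \<longleftrightarrow> v = basic b u"
  unfolding outputs_def by (auto intro: exec.Basic elim: exec_BasicE)

lemma outputs_Const [simp]: "outputs (Const d) u v \<longleftrightarrow> v = d"
  unfolding outputs_def by (auto intro: exec.Const elim: exec_ConstE)

lemma outputs_Prepend:
  "outputs (Prepend a b) u w \<longleftrightarrow> (\<exists>v vs. outputs a u v \<and> outputs b u (Lst vs) \<and> w = Lst (v # vs))"
  unfolding outputs_def by (fastforce intro: exec.Prepend elim: exec_PrependE)

lemma outputs_Comp: "outputs (Comp a b) u w \<longleftrightarrow> (\<exists>v. outputs b u v \<and> outputs a v w)"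
  unfolding outputs_def by (fastforce intro: exec.Comp elim: exec_CompE)

lemma outputs_Cond:
  "outputs (Cond p a b) u v \<longleftrightarrow>
     (\<exists>c. outputs p u c \<and> (if c = Num 0 then outputs b u v else outputs a u v))"
  unfolding outputs_def
  by (auto intro: exec.Cond_yes exec.Cond_no elim!: exec_CondE split: if_splits)

lemma outputs_While:
  "outputs (While p a) u w \<longleftrightarrow>
     (\<exists>c. outputs p u c \<and>
        (if c = Num 0 then w = u else \<exists>v. outputs a u v \<and> outputs (While p a) v w))"
  (is "_ \<longleftrightarrow> ?rhs")
proof
  assume "outputs (While p a) u w"
  then obtain t where "exec (While p a) u w t" by (auto simp: outputs_def)
  then show ?rhs
  proof (rule exec_WhileE)
    fix s assume "w = u" "exec p u (Num 0) s"
    then show ?rhs by (intro exI[of _ "Num 0"]) (auto simp: outputs_def)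
  next
    fix c r v s t
    assume "exec p u c r" "c \<noteq> Num 0" "exec a u v s" "exec (While p a) v w t"
    then show ?rhs by (intro exI[of _ c]) (auto simp: outputs_def)
  qed
next
  assume ?rhs
  then obtain c where "outputs p u c"
    "if c = Num 0 then w = u else \<exists>v. outputs a u v \<and> outputs (While p a) v w" by blast
  then show "outputs (While p a) u w"
    by (auto simp: outputs_def intro: exec.While_no exec.While_yes split: if_splits)
qed

lemma outputs_Run: "outputs Run u v \<longleftrightarrow> (\<exists>a x. u = Lst [Alg a, x] \<and> outputs a x v)"
  unfolding outputs_def by (fastforce intro: exec.Run elim: exec_RunE)

lemma outputs_tuple:
  "outputs (tuple as) u w \<longleftrightarrow> (\<exists>vs. w = Lst vs \<and> list_all2 (\<lambda>a v. outputs a u v) as vs)"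
proof (induction as arbitrary: w)
  case Nil
  then show ?case by (simp add: tuple_def)
next
  case (Cons a as)
  have "tuple (a # as) = Prepend a (tuple as)" by (simp add: tuple_def)
  then show ?case
    by (auto simp: outputs_Prepend Cons.IH list_all2_Cons1)
qed

lemma outputs_item:
  "k < length ds \<Longrightarrow> outputs (item k) (Lst ds) v \<longleftrightarrow> v = ds ! k"
proof (induction k arbitrary: ds)
  case 0
  then show ?case by (cases ds) auto
next
  case (Suc k)
  then show ?case by (cases ds) (auto simp: outputs_Comp)
qed

declare item.simps [simp del]

lemma While_halts_iff:
  assumes p: "\<And>i. outputs p (s i) (c i)"
    and a: "\<And>i. c i \<noteq> Num 0 \<Longrightarrow> outputs a (s i) (s (Suc i))"
  shows "outputs (While p a) (s 0) w \<longleftrightarrow> (\<exists>n. c n = Num 0 \<and> (\<forall>i<n. c i \<noteq> Num 0) \<and> w = s n)"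
proof
  have "\<lbrakk>exec b u w t; b = While p a; u = s j\<rbrakk> \<Longrightarrow>
      \<exists>n\<ge>j. c n = Num 0 \<and> (\<forall>i. j \<le> i \<and> i < n \<longrightarrow> c i \<noteq> Num 0) \<and> w = s n" for b u w t j
  proof (induction arbitrary: j rule: exec.induct)
    case (While_no q u r b)
    then have "outputs p (s j) (Num 0)" by (auto simp: outputs_def)
    then have "c j = Num 0" using outputs_deterministic p by metis
    then show ?case using While_no by (intro exI[of _ j]) auto
  next
    case (While_yes q u d r b v r' w t)
    then have "outputs p (s j) d" "outputs a (s j) v" by (auto simp: outputs_def)
    then have cj: "c j \<noteq> Num 0" and "v = s (Suc j)"
      using outputs_deterministic p a While_yes.hyps by metis+
    with While_yes.IH(3)[of "Suc j"] While_yes.prems obtain n where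
      n: "n \<ge> Suc j" "c n = Num 0" "\<forall>i. Suc j \<le> i \<and> i < n \<longrightarrow> c i \<noteq> Num 0" "w = s n"
      by blast
    have "\<forall>i. j \<le> i \<and> i < n \<longrightarrow> c i \<noteq> Num 0"
      using n(3) cj by (metis le_eq_less_or_eq Suc_leI)
    then show ?case using n by (intro exI[of _ n]) auto
  qed auto
  then show "outputs (While p a) (s 0) w \<Longrightarrow>
      \<exists>n. c n = Num 0 \<and> (\<forall>i<n. c i \<noteq> Num 0) \<and> w = s n"
    unfolding outputs_def by (metis le0)
next
  have runs: "c n = Num 0 \<Longrightarrow> (\<forall>i. j \<le> i \<and> i < n \<longrightarrow> c i \<noteq> Num 0) \<Longrightarrow> j \<le> n \<Longrightarrow>
      outputs (While p a) (s j) (s n)" for n j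
  proof (induction "n - j" arbitrary: j)
    case 0
    then show ?case using p[of j] by (subst outputs_While) (auto intro!: exI[of _ "c j"])
  next
    case (Suc d)
    then have "j < n" by simp
    have "outputs (While p a) (s (Suc j)) (s n)"
      using Suc \<open>j < n\<close> by (intro Suc.hyps(1)) auto
    moreover have "c j \<noteq> Num 0" using Suc \<open>j < n\<close> by simp
    ultimately show ?case using p[of j] a[of j] by (subst outputs_While) fastforce
  qed
  show "\<exists>n. c n = Num 0 \<and> (\<forall>i<n. c i \<noteq> Num 0) \<and> w = s n \<Longrightarrow> outputs (While p a) (s 0) w"
    using runs[of _ 0] by auto
qed

lemma outputs_test_equal:
  assumes "outputs a u x" "outputs b u y"
  shows "outputs (test_equal a b) u v \<longleftrightarrow> v = Num (if x = y then 1 else 0)"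
proof -
  have "outputs (tuple [a, b]) u w \<longleftrightarrow> w = Lst [x, y]" for w
    using assms outputs_deterministic
    by (auto simp: outputs_tuple list_all2_Cons1)
  then show ?thesis by (simp add: test_equal_def outputs_Comp)
qed

lemma outputs_negate:
  assumes "outputs p u c"
  shows "outputs (negate p) u v \<longleftrightarrow> v = Num (if c = Num 0 then 1 else 0)"
proof -
  have "outputs p u d \<longleftrightarrow> d = c" for d
    using assms outputs_deterministic by blast
  then show ?thesis by (auto simp: negate_def outputs_Cond)
qed

lemma outputs_member_prog:
  "outputs member_prog (Lst [x, Lst xs]) v \<longleftrightarrow> v = Num (if x \<in> set xs then 1 else 0)"
proof -
  define empty where "empty = test_equal (item 1) (Const (Lst []))"
  define found where "found = test_equal (item 0) (Comp (Basic Head) (item 1))"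
  define loop where "loop = While (Cond empty (Const (Num 0)) (negate found))
      (tuple [item 0, Comp (Basic Tail) (item 1)])"
  have empty: "outputs empty (Lst [x, Lst ys]) v \<longleftrightarrow> v = Num (if ys = [] then 1 else 0)" for ys v
    unfolding empty_def
    by (subst outputs_test_equal[of _ _ "Lst ys" _ "Lst []"]) (auto simp: outputs_item)
  have found: "outputs found (Lst [x, Lst (y # ys)]) v \<longleftrightarrow> v = Num (if x = y then 1 else 0)" for y ys v
    unfolding found_def
    by (subst outputs_test_equal[of _ _ x _ y]) (auto simp: outputs_item outputs_Comp)
  have loop: "\<exists>ys. outputs loop (Lst [x, Lst xs]) (Lst [x, Lst ys]) \<and> (ys = [] \<longleftrightarrow> x \<notin> set xs)" for xs
  proof (induction xs)
    case Nil
    then show ?case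
      by (auto simp: loop_def outputs_While[of _ _ "Lst [x, Lst []]"] outputs_Cond empty)
  next
    case (Cons z zs)
    have neg: "outputs (negate found) (Lst [x, Lst (z # zs)]) v
        \<longleftrightarrow> v = Num (if x = z then 0 else 1)" for v
      by (subst outputs_negate[of _ _ "Num (if x = z then 1 else 0)"]) (auto simp: found)
    have body: "outputs (tuple [item 0, Comp (Basic Tail) (item 1)]) (Lst [x, Lst (z # zs)])
        (Lst [x, Lst zs])"
      by (simp add: outputs_tuple outputs_item outputs_Comp)
    show ?case
    proof (cases "x = z")
      case True
      then have "outputs (negate found) (Lst [x, Lst (z # zs)]) (Num 0)"
        using neg by simp
      then have "outputs loop (Lst [x, Lst (z # zs)]) (Lst [x, Lst (z # zs)])"
        unfolding loop_def by (subst outputs_While) (auto simp: outputs_Cond empty)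
      then show ?thesis using True by auto
    next
      case False
      obtain ys where ys: "outputs loop (Lst [x, Lst zs]) (Lst [x, Lst ys])"
          "ys = [] \<longleftrightarrow> x \<notin> set zs" using Cons by blast
      have "outputs loop (Lst [x, Lst (z # zs)]) (Lst [x, Lst ys])"
        using ys(1) body False unfolding loop_def
        by (subst outputs_While) (auto simp: outputs_Cond empty neg)
      then show ?thesis using ys False by auto
    qed
  qed
  have mp: "member_prog = Comp (negate empty) loop"
    by (simp add: member_prog_def empty_def found_def loop_def Let_def)
  obtain ys where ys: "outputs loop (Lst [x, Lst xs]) (Lst [x, Lst ys])"
      "ys = [] \<longleftrightarrow> x \<notin> set xs" using loop by blast
  have "outputs member_prog (Lst [x, Lst xs]) v \<longleftrightarrow> outputs (negate empty) (Lst [x, Lst ys]) v"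
    using ys(1) outputs_deterministic unfolding mp by (auto simp: outputs_Comp)
  also have "\<dots> \<longleftrightarrow> v = Num (if ys = [] then 0 else 1)"
    by (subst outputs_negate[of _ _ "Num (if ys = [] then 1 else 0)"]) (auto simp: empty)
  finally show ?thesis using ys(2) by auto
qed

text \<open>
  The lists \<open>H\<^sub>0, H\<^sub>1, \<dots>\<close> in the description of deduction, and the fact that
  \<open>deduce\<close> searches through them.
\<close>

definition deduction_stages :: "algo \<Rightarrow> algo \<Rightarrow> datum list \<Rightarrow> (nat \<Rightarrow> datum list) \<Rightarrow> bool" where
  "deduction_stages \<phi> \<rho> \<Gamma> H \<longleftrightarrow> H 0 = \<Gamma> \<and>
     (\<forall>i. \<exists>k m R. outputs \<phi> (Num (Suc i)) (Lst [Num k, Num m]) \<and> outputs \<rho> (Num k) (Alg R) \<and>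
        outputs R (rule_input (H i) \<rho> m) (Lst (H (Suc i))))"

lemma deduce_correct:
  assumes "deduction_stages \<phi> \<rho> \<Gamma> H"
  shows "outputs (deduce \<phi>) (Lst [Lst \<Gamma>, Alg \<rho>, B]) v \<longleftrightarrow> v = Num 1 \<and> (\<exists>i. B \<in> set (H i))"
proof -
  define continue where "continue = negate (Comp member_prog (tuple [item 3, item 0]))"
  define body where "body = (
     let next = Comp (Basic Succ) (item 1);
          pair = Comp \<phi> next;
          rule_k = Comp Run (tuple [item 2, Comp (item 0) pair]);
          apply_rule = Comp Run (tuple [rule_k, tuple [item 0, item 2, Comp (item 1) pair]])
      in tuple [apply_rule, next, item 2, item 3])"
  define init where "init = tuple [item 0, Const (Num 0), item 1, item 2]"
  define s where "s i = Lst [Lst (H i), Num i, Alg \<rho>, B]" for i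
  have D: "deduce \<phi> = Comp (Const (Num 1)) (Comp (While continue body) init)"
    by (simp add: deduce_def continue_def body_def init_def Let_def)
  have item: "outputs (item 0) (s i) (Lst (H i))" "outputs (item 1) (s i) (Num i)"
    "outputs (item 2) (s i) (Alg \<rho>)" "outputs (item 3) (s i) B" for i
    by (simp_all add: s_def outputs_item)
  have init: "outputs init (Lst [Lst \<Gamma>, Alg \<rho>, B]) w \<longleftrightarrow> w = s 0" for w
    using assms unfolding init_def deduction_stages_def
    by (auto simp: outputs_tuple list_all2_Cons1 outputs_item s_def)
  have continue: "outputs continue (s i) (Num (if B \<in> set (H i) then 0 else 1))" for i
  proof -
    have "outputs (tuple [item 3, item 0]) (s i) (Lst [B, Lst (H i)])"
      using item by (simp add: outputs_tuple)
    then have "outputs (Comp member_prog (tuple [item 3, item 0])) (s i)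
        (Num (if B \<in> set (H i) then 1 else 0))"
      unfolding outputs_Comp using outputs_member_prog by blast
    then show ?thesis unfolding continue_def by (subst outputs_negate) auto
  qed
  have body: "outputs body (s i) (s (Suc i))" for i
  proof -
    obtain k m R where kmR: "outputs \<phi> (Num (Suc i)) (Lst [Num k, Num m])"
      "outputs \<rho> (Num k) (Alg R)" "outputs R (rule_input (H i) \<rho> m) (Lst (H (Suc i)))"
      using assms unfolding deduction_stages_def by blast
    define nxt where "nxt = Comp (Basic Succ) (item 1)"
    define pair where "pair = Comp \<phi> nxt"
    define rule_k where "rule_k = Comp Run (tuple [item 2, Comp (item 0) pair])"
    have nxt: "outputs nxt (s i) (Num (Suc i))"
      unfolding nxt_def outputs_Comp using item(2)[of i]
      by (intro exI[of _ "Num i"]) (simp)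
    have pair: "outputs pair (s i) (Lst [Num k, Num m])"
      unfolding pair_def outputs_Comp using nxt kmR(1) by blast
    have pk: "outputs (Comp (item 0) pair) (s i) (Num k)"
      "outputs (Comp (item 1) pair) (s i) (Num m)"
      unfolding outputs_Comp using pair
      by (auto intro!: exI[of _ "Lst [Num k, Num m]"] simp: outputs_item)
    have "outputs (tuple [item 2, Comp (item 0) pair]) (s i) (Lst [Alg \<rho>, Num k])"
      using item pk by (simp add: outputs_tuple)
    then have rk: "outputs rule_k (s i) (Alg R)"
      unfolding rule_k_def outputs_Comp outputs_Run using kmR(2) by blast
    have "outputs (tuple [item 0, item 2, Comp (item 1) pair]) (s i) (rule_input (H i) \<rho> m)"
      using item pk by (simp add: outputs_tuple)
    then have "outputs (tuple [rule_k, tuple [item 0, item 2, Comp (item 1) pair]]) (s i)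
        (Lst [Alg R, rule_input (H i) \<rho> m])"
      using rk by (subst outputs_tuple) simp
    then have "outputs (Comp Run (tuple [rule_k, tuple [item 0, item 2, Comp (item 1) pair]])) (s i)
        (Lst (H (Suc i)))"
      unfolding outputs_Comp outputs_Run using kmR(3) by blast
    then have "outputs (tuple [Comp Run (tuple [rule_k, tuple [item 0, item 2, Comp (item 1) pair]]),
        nxt, item 2, item 3]) (s i) (Lst [Lst (H (Suc i)), Num (Suc i), Alg \<rho>, B])"
      using nxt item by (subst outputs_tuple) (simp)
    then show ?thesis
      by (simp add: body_def Let_def nxt_def pair_def rule_k_def s_def)
  qed
  have "(\<exists>w. outputs (While continue body) (s 0) w) \<longleftrightarrow> (\<exists>i. B \<in> set (H i))"
  proof -
    have *: "outputs (While continue body) (s 0) w \<longleftrightarrow>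
        (\<exists>n. Num (if B \<in> set (H n) then 0 else 1) = Num 0 \<and>
          (\<forall>i<n. Num (if B \<in> set (H i) then 0 else 1) \<noteq> Num 0) \<and> w = s n)" for w
      by (rule While_halts_iff) (use continue body in auto)
    have **: "outputs (While continue body) (s 0) w \<longleftrightarrow>
        (\<exists>n. B \<in> set (H n) \<and> (\<forall>i<n. B \<notin> set (H i)) \<and> w = s n)" for w
    proof -
      have "Num (if B \<in> set (H i) then 0 else 1) = Num 0 \<longleftrightarrow> B \<in> set (H i)" for i
        by simp
      then show ?thesis using * by presburger
    qed
    show ?thesis unfolding ** using exists_least_iff[of "\<lambda>i. B \<in> set (H i)"] by blast
  qed
  then show ?thesis by (auto simp: D outputs_Comp init)
qed

lemma rule_outputs:
  "\<lbrakk>rule R; hypothesis_list H; algorithmic_sequence \<rho>; m \<ge> 1\<rbrakk> \<Longrightarrow>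
     \<exists>C. outputs R (rule_input H \<rho> m) (Lst (H @ C)) \<and> hypothesis_list (H @ C)"
  unfolding rule_def by (elim conjE) simp

lemma ex_deduction_stages:
  assumes \<phi>: "pair_enumeration \<phi>" and \<rho>: "library \<rho>" and \<Gamma>: "hypothesis_list \<Gamma>"
  shows "\<exists>H. deduction_stages \<phi> \<rho> \<Gamma> H \<and> (\<forall>i. hypothesis_list (H i))"
proof -
  obtain f where f: "bij_betw f {1..} ({1..} \<times> {1..})"
    "\<And>i. i \<ge> 1 \<Longrightarrow> outputs \<phi> (Num i) (Lst [Num (fst (f i)), Num (snd (f i))])"
    using \<phi> unfolding pair_enumeration_def by blast
  have seq: "algorithmic_sequence \<rho>"
    using \<rho> unfolding library_def algorithmic_sequence_def by blast
  have "\<exists>G'. hypothesis_list G' \<and> (\<exists>k m R. outputs \<phi> (Num (Suc i)) (Lst [Num k, Num m]) \<and>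
        outputs \<rho> (Num k) (Alg R) \<and> outputs R (rule_input G \<rho> m) (Lst G'))"
    if G: "hypothesis_list G" for i G
  proof -
    obtain k m where km: "f (Suc i) = (k, m)" by fastforce
    have "f (Suc i) \<in> {1..} \<times> {1..}" using f(1) by (auto simp: bij_betw_def)
    then have "k \<ge> 1" "m \<ge> 1" using km by auto
    obtain R where R: "outputs \<rho> (Num k) (Alg R)" "rule R"
      using \<rho> \<open>k \<ge> 1\<close> unfolding library_def by blast
    then obtain C where "outputs R (rule_input G \<rho> m) (Lst (G @ C))" "hypothesis_list (G @ C)"
      using G seq \<open>m \<ge> 1\<close> rule_outputs by blast
    then show ?thesis using R f(2)[of "Suc i"] km by auto
  qed
  then have "\<exists>H. H 0 = \<Gamma> \<and> (\<forall>i. hypothesis_list (H i) \<and> (\<exists>k m R.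
        outputs \<phi> (Num (Suc i)) (Lst [Num k, Num m]) \<and> outputs \<rho> (Num k) (Alg R) \<and>
        outputs R (rule_input (H i) \<rho> m) (Lst (H (Suc i)))))"
    using dependent_nat_choice[of "\<lambda>i G. hypothesis_list G \<and> (i = 0 \<longrightarrow> G = \<Gamma>)"
      "\<lambda>i G G'. \<exists>k m R. outputs \<phi> (Num (Suc i)) (Lst [Num k, Num m]) \<and>
        outputs \<rho> (Num k) (Alg R) \<and> outputs R (rule_input G \<rho> m) (Lst G')"] \<Gamma>
    by (smt (verit) nat.distinct(1))
  then show ?thesis unfolding deduction_stages_def by blast
qed

lemma ex_pair_enumeration: "\<exists>\<phi>. pair_enumeration \<phi>"
proof -
  define step where "step = (\<lambda>(a, b). if b = 0 then (0, Suc a) else (Suc a, b - 1 :: nat))"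
  have step: "prod_decode (Suc n) = step (prod_decode n)" for n
  proof -
    have "prod_encode (step (a, b)) = Suc (prod_encode (a, b))" for a b
      by (cases b) (auto simp: step_def prod_encode_def)
    then have "prod_encode (step (prod_decode n)) = Suc n"
      by (metis prod.collapse prod_decode_inverse)
    then show ?thesis by (metis prod_encode_inverse)
  qed
  define f where "f i = map_prod Suc Suc (prod_decode (i - 1))" for i
  have bij: "bij_betw f {1..} ({1..} \<times> {1..})"
  proof -
    have "bij_betw (\<lambda>i. i - 1) {1..} (UNIV :: nat set)"
      by (rule bij_betw_byWitness[of _ Suc]) auto
    moreover have "bij_betw prod_decode UNIV UNIV" by (rule bij_prod_decode)
    moreover have "bij_betw (map_prod Suc Suc) UNIV ({1..} \<times> {1..})"
      by (rule bij_betw_byWitness[of _ "map_prod (\<lambda>i. i - 1) (\<lambda>i. i - 1)"]) auto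
    ultimately have "bij_betw (map_prod Suc Suc \<circ> (prod_decode \<circ> (\<lambda>i. i - 1))) {1..} ({1..} \<times> {1..})"
      by (intro bij_betw_trans)
    then show ?thesis by (simp add: f_def[abs_def] o_def)
  qed
  define nx where "nx = Cond (test_equal (item 2) (Const (Num 1)))
     (tuple [Comp (Basic Pred) (item 0), Const (Num 1), Comp (Basic Succ) (item 1)])
     (tuple [Comp (Basic Pred) (item 0), Comp (Basic Succ) (item 1), Comp (Basic Pred) (item 2)])"
  define p where "p = negate (test_equal (item 0) (Const (Num 1)))"
  define \<phi> where "\<phi> = Comp (Basic Tail) (Comp (While p nx)
     (tuple [Basic Ident, Const (Num 1), Const (Num 1)]))"
  have "outputs \<phi> (Num (Suc n)) (Lst [Num (fst (f (Suc n))), Num (snd (f (Suc n)))])" for n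
  proof -
    let ?s = "\<lambda>i j. Lst [Num i, Num (fst (f j)), Num (snd (f j))]"
    have p: "outputs p (?s i j) v \<longleftrightarrow> v = Num (if i = 1 then 0 else 1)" for i j v
    proof -
      have "outputs (test_equal (item 0) (Const (Num 1))) (?s i j) (Num (if Num i = Num 1 then 1 else 0))"
        by (subst outputs_test_equal) (auto simp: outputs_item)
      then show ?thesis unfolding p_def by (subst outputs_negate) auto
    qed
    have nx_step: "outputs nx (?s (Suc i) (Suc j)) (?s i (Suc (Suc j)))" for i j
    proof -
      obtain a b where ab: "prod_decode j = (a, b)" by fastforce
      have 1: "f (Suc j) = (Suc a, Suc b)" by (simp add: f_def ab)
      have 2: "f (Suc (Suc j)) = (if b = 0 then (1, Suc (Suc a)) else (Suc (Suc a), b))"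
        by (simp add: f_def step ab step_def)
      have "outputs (test_equal (item 2) (Const (Num 1))) (?s (Suc i) (Suc j)) v
          \<longleftrightarrow> v = Num (if Num (Suc b) = Num 1 then 1 else 0)" for v
        by (subst outputs_test_equal) (auto simp: outputs_item 1)
      then show ?thesis unfolding nx_def
        by (simp add: outputs_Cond outputs_tuple outputs_Comp outputs_item 1 2)
    qed
    have "outputs (While p nx) (?s (Suc d) (Suc j)) (?s 1 (Suc (j + d)))" for d j
    proof (induction d arbitrary: j)
      case 0
      then show ?case by (subst outputs_While) (simp add: p)
    next
      case (Suc d)
      show ?case using Suc[of "Suc j"] nx_step[of "Suc d" j] by (subst outputs_While) (auto simp: p)
    qed
    from this[of n 0] have "outputs (While p nx) (?s (Suc n) 1) (?s 1 (Suc n))" by simp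
    moreover have "outputs (tuple [Basic Ident, Const (Num 1), Const (Num 1)]) (Num (Suc n)) (?s (Suc n) 1)"
      by (simp add: outputs_tuple f_def prod_decode_def prod_decode_aux.simps)
    ultimately have "outputs (Comp (While p nx) (tuple [Basic Ident, Const (Num 1), Const (Num 1)]))
        (Num (Suc n)) (?s 1 (Suc n))"
      unfolding outputs_Comp[of "While p nx"] by blast
    then show ?thesis unfolding \<phi>_def outputs_Comp[of "Basic Tail"] by fastforce
  qed
  then have "pair_enumeration \<phi>"
    unfolding pair_enumeration_def using bij by (metis One_nat_def Suc_le_D)
  then show ?thesis by blast
qed

text \<open>Input \<open>[xs, ys]\<close>: outputs \<open>rev xs @ ys\<close>.\<close>

definition rev_append_prog :: algo where
  "rev_append_prog = Comp (item 1)
     (While (negate (test_equal (item 0) (Const (Lst []))))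
        (tuple [Comp (Basic Tail) (item 0), Prepend (Comp (Basic Head) (item 0)) (item 1)]))"

lemma outputs_rev_append_prog:
  "outputs rev_append_prog (Lst [Lst xs, Lst ys]) (Lst (rev xs @ ys))"
proof -
  define p where "p = negate (test_equal (item 0) (Const (Lst [])))"
  define b where "b = tuple [Comp (Basic Tail) (item 0), Prepend (Comp (Basic Head) (item 0)) (item 1)]"
  have p: "outputs p (Lst [Lst xs, Lst ys]) v \<longleftrightarrow> v = Num (if xs = [] then 0 else 1)" for xs ys v
  proof -
    have "outputs (test_equal (item 0) (Const (Lst []))) (Lst [Lst xs, Lst ys])
        (Num (if Lst xs = Lst [] then 1 else 0))"
      by (subst outputs_test_equal) (auto simp: outputs_item)
    then show ?thesis unfolding p_def by (subst outputs_negate) auto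
  qed
  have b: "outputs b (Lst [Lst (x # xs), Lst ys]) (Lst [Lst xs, Lst (x # ys)])" for x xs ys
    unfolding b_def
    by (simp add: outputs_tuple outputs_Comp outputs_Prepend outputs_item)
  have "outputs (While p b) (Lst [Lst xs, Lst ys]) (Lst [Lst [], Lst (rev xs @ ys)])" for xs ys
  proof (induction xs arbitrary: ys)
    case Nil
    then show ?case by (subst outputs_While) (simp add: p)
  next
    case (Cons x xs)
    show ?case using Cons[of "x # ys"] b[of x xs ys] by (subst outputs_While) (auto simp: p)
  qed
  then show ?thesis unfolding rev_append_prog_def p_def[symmetric] b_def[symmetric] outputs_Comp
    by (intro exI[of _ "Lst [Lst [], Lst (rev xs @ ys)]"]) (simp add: outputs_item)
qed

lemma ex_double_neg_rule: "\<exists>P. implements_diagram P (double_neg_diagram \<phi>)"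
proof -
  let ?nn = "\<lambda>\<rho> A. neg \<phi> (Alg \<rho>) (neg \<phi> (Alg \<rho>) A)"
  define ng where "ng a = tuple [Const (Alg (deduce \<phi>)), tuple [tuple [a], item 2, Const falsum],
      Const (Num 1)]" for a
  define p where "p = negate (test_equal (item 0) (Const (Lst [])))"
  define b where "b = tuple [Comp (Basic Tail) (item 0),
      Prepend (ng (ng (Comp (Basic Head) (item 0)))) (item 1), item 2]"
  define L where "L = Comp (item 1) (Comp (While p b) (tuple [item 0, Const (Lst []), item 1]))"
  define P where "P = Comp rev_append_prog
      (tuple [Comp rev_append_prog (tuple [item 0, Const (Lst [])]), L])"
  have ng: "outputs (ng a) u (neg \<phi> \<rho> A)" if "outputs a u A" "outputs (item 2) u \<rho>" for a u A \<rho>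
    using that unfolding ng_def
    by (simp add: outputs_tuple neg_def implies_def entails_def)
  have p: "outputs p (Lst [Lst xs, Lst ys, r]) v \<longleftrightarrow> v = Num (if xs = [] then 0 else 1)" for xs ys r v
  proof -
    have "outputs (test_equal (item 0) (Const (Lst []))) (Lst [Lst xs, Lst ys, r])
        (Num (if Lst xs = Lst [] then 1 else 0))"
      by (subst outputs_test_equal) (auto simp: outputs_item)
    then show ?thesis unfolding p_def by (subst outputs_negate) auto
  qed
  have b: "outputs b (Lst [Lst (x # xs), Lst ys, Alg \<rho>]) (Lst [Lst xs, Lst (?nn \<rho> x # ys), Alg \<rho>])"
    for x xs ys \<rho>
  proof -
    let ?u = "Lst [Lst (x # xs), Lst ys, Alg \<rho>]"
    have i2: "outputs (item 2) ?u (Alg \<rho>)" by (simp add: outputs_item)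
    have "outputs (Comp (Basic Head) (item 0)) ?u x"
      by (simp add: outputs_Comp outputs_item)
    then have "outputs (ng (ng (Comp (Basic Head) (item 0)))) ?u (?nn \<rho> x)"
      using ng i2 by blast
    then show ?thesis unfolding b_def
      by (simp add: outputs_tuple outputs_Comp outputs_Prepend outputs_item)
  qed
  have W: "outputs (While p b) (Lst [Lst xs, Lst ys, Alg \<rho>])
      (Lst [Lst [], Lst (rev (map (?nn \<rho>) xs) @ ys), Alg \<rho>])" for xs ys \<rho>
  proof (induction xs arbitrary: ys)
    case Nil
    then show ?case by (subst outputs_While) (simp add: p)
  next
    case (Cons x xs)
    show ?case using Cons[of "?nn \<rho> x # ys"] b[of x xs ys \<rho>]
      by (subst outputs_While) (auto simp: p)
  qed
  have "outputs P (rule_input H \<rho> m) (Lst (H @ rev (map (?nn \<rho>) H)))" for H \<rho> m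
  proof -
    let ?u = "rule_input H \<rho> m" and ?E = "rev (map (?nn \<rho>) H)"
    have "outputs (tuple [item 0, Const (Lst []), item 1]) ?u (Lst [Lst H, Lst [], Alg \<rho>])"
      by (simp add: outputs_tuple outputs_item)
    then have "outputs (Comp (While p b) (tuple [item 0, Const (Lst []), item 1])) ?u
        (Lst [Lst [], Lst ?E, Alg \<rho>])"
      unfolding outputs_Comp[of "While p b"] using W[of H "[]" \<rho>] by auto
    then have L: "outputs L ?u (Lst ?E)"
      unfolding L_def outputs_Comp[of "item 1"]
      by (intro exI[of _ "Lst [Lst [], Lst ?E, Alg \<rho>]"]) (simp add: outputs_item)
    have "outputs (tuple [item 0, Const (Lst [])]) ?u (Lst [Lst H, Lst []])"
      by (simp add: outputs_tuple outputs_item)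
    then have "outputs (Comp rev_append_prog (tuple [item 0, Const (Lst [])])) ?u (Lst (rev H))"
      unfolding outputs_Comp[of rev_append_prog] using outputs_rev_append_prog[of H "[]"] by auto
    then have "outputs (tuple [Comp rev_append_prog (tuple [item 0, Const (Lst [])]), L]) ?u
        (Lst [Lst (rev H), Lst ?E])"
      using L by (subst outputs_tuple) simp
    then show ?thesis
      unfolding P_def outputs_Comp[of rev_append_prog _ ?u]
      using outputs_rev_append_prog[of "rev H" ?E] by auto
  qed
  moreover have "set (rev (map (?nn \<rho>) H)) =
      {Y. \<exists>Xs. (Xs, Y) \<in> double_neg_diagram \<phi> \<rho> \<and> set Xs \<subseteq> set H}"
    if "hypothesis_list H" for H \<rho>
    using that by (fastforce simp: double_neg_diagram_def hypothesis_list_def)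
  ultimately have "implements_diagram P (double_neg_diagram \<phi>)"
    unfolding implements_diagram_def by blast
  then show ?thesis by blast
qed

lemma implements_double_neg_rule:
  assumes "implements_diagram P (double_neg_diagram \<phi>)"
  shows "rule P"
proof -
  have D: "algorithmic_statement Y" if "(Xs, Y) \<in> double_neg_diagram \<phi> \<rho>" for Xs Y \<rho>
    using that by (auto simp: double_neg_diagram_def algorithmic_statement_def neg_def
        implies_def entails_def)
  let ?E = "\<lambda>H \<rho>. {Y. \<exists>Xs. (Xs, Y) \<in> double_neg_diagram \<phi> \<rho> \<and> set Xs \<subseteq> set H}"
  have out: "\<exists>C. outputs P (rule_input H \<rho> m) (Lst (H @ C)) \<and> set C = ?E H \<rho>"
    if "hypothesis_list H" "algorithmic_sequence \<rho>" "m \<ge> 1" for H \<rho> m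
    using assms that unfolding implements_diagram_def by blast
  have out': "set C = set H \<union> ?E H \<rho>"
    if in_H: "hypothesis_list H" "algorithmic_sequence \<rho>" "m \<ge> 1"
      and out_C: "outputs P (rule_input H \<rho> m) (Lst C)" for H \<rho> m C
  proof -
    obtain C' where "outputs P (rule_input H \<rho> m) (Lst (H @ C'))" "set C' = ?E H \<rho>"
      using out[OF in_H] by blast
    moreover from this have "Lst (H @ C') = Lst C"
      using outputs_deterministic out_C by blast
    ultimately show ?thesis by auto
  qed
  show ?thesis unfolding rule_def
  proof (intro conjI allI impI; (elim conjE)?)
    fix H \<rho> and m :: nat
    assume a: "hypothesis_list H" "algorithmic_sequence \<rho>" "1 \<le> m"
    from out[OF a] obtain C where C: "outputs P (rule_input H \<rho> m) (Lst (H @ C))" "set C = ?E H \<rho>"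
      by blast
    then have "hypothesis_list (H @ C)" using a(1) D unfolding hypothesis_list_def by auto
    with C show "\<exists>C. outputs P (rule_input H \<rho> m) (Lst (H @ C)) \<and> hypothesis_list (H @ C)" by blast
  next
    fix H H' \<rho> C C' and m m' :: nat
    assume a: "hypothesis_list H" "hypothesis_list H'" "algorithmic_sequence \<rho>" "1 \<le> m" "m \<le> m'"
      "set H \<subseteq> set H'" "outputs P (rule_input H \<rho> m) (Lst C)"
      "outputs P (rule_input H' \<rho> m') (Lst C')"
    have "set C = set H \<union> ?E H \<rho>" using a out' by blast
    moreover have "set C' = set H' \<union> ?E H' \<rho>"
      using a out'[of H' \<rho> m' C'] by linarith
    ultimately show "set C \<subseteq> set C'" using a(6) by blast
  qed
qed

end

theory Submission
  imports Defs
begin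

text \<open>
  Write \<open>D\<close> for \<open>\<not>\<^sub>\<rho> \<T>\<close>, that is \<open>\<T> \<turnstile>\<^sub>\<rho> \<F>\<close>. Add to the base a rule that
  appends \<open>D\<close> as soon as \<open>\<F>\<close> has been deduced from \<open>D\<close>. If this rule
  ever fires, then \<open>\<T> \<turnstile>\<^sub>\<rho> D\<close> and \<open>D \<turnstile>\<^sub>\<rho> \<F>\<close>, so \<open>D\<close> is true and the
  rule is valid; by stability the whole library is valid, which contradicts
  \<open>\<T> \<turnstile>\<^sub>\<rho> \<F>\<close>. So the rule never fires; hence it is valid, and \<open>\<F>\<close> cannot be
  deduced from \<open>D\<close>. To be total, the rule does not run the rules of its
  nominal library \<open>\<rho>\<close>, which may be an arbitrary algorithmic sequence: it carries the other
  rules of the intended library as a constant, and until it fires it may itself be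
  replaced by the identity rule.
\<close>

section \<open>Consequences of the definitions of rule, library and pair enumeration\<close>

lemma library_algorithmic_sequence: "library \<rho> \<Longrightarrow> algorithmic_sequence \<rho>"
  unfolding library_def algorithmic_sequence_def by blast

lemma library_rule: "\<lbrakk>library \<rho>; R \<in> rules_of \<rho>\<rbrakk> \<Longrightarrow> rule R"
  unfolding library_def rules_of_def using outputs_deterministic by fastforce

lemma rule_extends:
  assumes "rule R" "hypothesis_list H" "algorithmic_sequence \<rho>" "m \<ge> 1"
    and "outputs R (rule_input H \<rho> m) (Lst C)"
  shows "set H \<subseteq> set C" "hypothesis_list C"
proof -
  obtain C' where "outputs R (rule_input H \<rho> m) (Lst (H @ C'))" "hypothesis_list (H @ C')"
    using rule_outputs[OF assms(1-4)] by blast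
  moreover from this have "C = H @ C'"
    using outputs_deterministic[OF assms(5)] by blast
  ultimately show "set H \<subseteq> set C" "hypothesis_list C" by auto
qed

lemma rule_mono:
  assumes "rule R" "hypothesis_list H" "hypothesis_list H'" "algorithmic_sequence \<rho>"
    and "m \<ge> 1" "m \<le> m'" "set H \<subseteq> set H'"
    and "outputs R (rule_input H \<rho> m) (Lst C)" "outputs R (rule_input H' \<rho> m') (Lst C')"
  shows "set C \<subseteq> set C'"
  using assms unfolding rule_def by metis

lemma pair_enumeration_positive:
  assumes "pair_enumeration \<phi>" "outputs \<phi> (Num (Suc i)) (Lst [Num k, Num m])"
  shows "k \<ge> 1" "m \<ge> 1"
proof -
  obtain f where f: "bij_betw f {1..} ({1..} \<times> {1..})"
    "\<And>i. i \<ge> 1 \<Longrightarrow> outputs \<phi> (Num i) (Lst [Num (fst (f i)), Num (snd (f i))])"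
    using assms(1) unfolding pair_enumeration_def by blast
  have "f (Suc i) \<in> {1..} \<times> {1..}" using f(1) by (auto simp: bij_betw_def)
  moreover have "f (Suc i) = (k, m)"
    using outputs_deterministic[OF assms(2) f(2)[of "Suc i"]] by (simp add: prod_eq_iff)
  ultimately show "k \<ge> 1" "m \<ge> 1" by auto
qed

text \<open>Every rule is applied again arbitrarily late and with arbitrarily large resource. The
  indices of the pairs \<open>(k, Suc (M + m))\<close> for varying \<open>m\<close> are pairwise
  distinct, so they cannot all be at most \<open>j\<close>.\<close>

lemma pair_enumeration_cofinal:
  assumes "pair_enumeration \<phi>" "k \<ge> 1"
  shows "\<exists>i\<ge>j. \<exists>m\<ge>M. outputs \<phi> (Num (Suc i)) (Lst [Num k, Num m])"
proof -
  obtain f where f: "bij_betw f {1..} ({1..} \<times> {1..})"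
    "\<And>i. i \<ge> 1 \<Longrightarrow> outputs \<phi> (Num i) (Lst [Num (fst (f i)), Num (snd (f i))])"
    using assms(1) unfolding pair_enumeration_def by blast
  define g where "g m = inv_into {1..} f (k, Suc (M + m))" for m
  have pos: "g m \<ge> 1" and fg: "f (g m) = (k, Suc (M + m))" for m
  proof -
    have "(k, Suc (M + m)) \<in> f ` {1..}"
      using f(1) assms(2) by (auto simp: bij_betw_def)
    then show "g m \<ge> 1" "f (g m) = (k, Suc (M + m))"
      unfolding g_def using inv_into_into[of _ f "{1..}"] by (auto simp: f_inv_into_f)
  qed
  have "inj g" by (rule injI) (metis fg add_left_imp_eq old.nat.inject prod.inject)
  then have "infinite (range g)" by (simp add: finite_image_iff)
  then have "\<not> range g \<subseteq> {..j}" using finite_subset by blast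
  then obtain m where "g m > j" by (auto simp: image_subset_iff not_le)
  moreover have "outputs \<phi> (Num (g m)) (Lst [Num k, Num (Suc (M + m))])"
    using f(2)[OF pos[of m]] fg[of m] by simp
  \<comment> \<open>The index \<open>g m\<close> governs the step that leaves stage
    \<open>g m - 1\<close>, and \<open>g m > j\<close> makes that stage at least
    \<open>j\<close>.\<close>
  ultimately show ?thesis
    by (intro exI[of _ "g m - 1"] conjI exI[of _ "Suc (M + m)"]) auto
qed


section \<open>Deduction with a separate nominal library\<close>

text \<open>The rules applied come from \<open>\<tau>\<close>, but each is given
  \<open>\<rho>\<close> as its nominal library. The two are separated because the rule built below
  has to halt for an arbitrary algorithmic sequence \<open>\<rho>\<close>, whose terms need not be
  rules.\<close>

definition nominal_stages ::
    "algo \<Rightarrow> algo \<Rightarrow> algo \<Rightarrow> datum list \<Rightarrow> (nat \<Rightarrow> datum list) \<Rightarrow> bool" where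
  "nominal_stages \<phi> \<tau> \<rho> \<Gamma> H \<longleftrightarrow> H 0 = \<Gamma> \<and>
     (\<forall>i. \<exists>k m R. outputs \<phi> (Num (Suc i)) (Lst [Num k, Num m]) \<and> outputs \<tau> (Num k) (Alg R) \<and>
        outputs R (rule_input (H i) \<rho> m) (Lst (H (Suc i))))"

lemma deduction_stages_nominal: "deduction_stages \<phi> \<rho> = nominal_stages \<phi> \<rho> \<rho>"
  by (intro ext) (simp add: deduction_stages_def nominal_stages_def)

lemma nominal_stagesE:
  assumes "pair_enumeration \<phi>" "library \<tau>" "nominal_stages \<phi> \<tau> \<rho> \<Gamma> H"
  obtains k m R where "outputs \<phi> (Num (Suc i)) (Lst [Num k, Num m])" "k \<ge> 1" "m \<ge> 1"
    "outputs \<tau> (Num k) (Alg R)" "R \<in> rules_of \<tau>" "rule R"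
    "outputs R (rule_input (H i) \<rho> m) (Lst (H (Suc i)))"
proof -
  obtain k m R where *: "outputs \<phi> (Num (Suc i)) (Lst [Num k, Num m])"
    "outputs \<tau> (Num k) (Alg R)" "outputs R (rule_input (H i) \<rho> m) (Lst (H (Suc i)))"
    using assms(3) unfolding nominal_stages_def by blast
  moreover have km: "k \<ge> 1" "m \<ge> 1" using pair_enumeration_positive[OF assms(1) *(1)] by auto
  moreover have "R \<in> rules_of \<tau>" using km * by (auto simp: rules_of_def)
  ultimately show ?thesis using that library_rule[OF assms(2)] by blast
qed

lemma nominal_stages_step:
  assumes "pair_enumeration \<phi>" "library \<tau>" "nominal_stages \<phi> \<tau> \<rho> \<Gamma> H"
    and "outputs \<phi> (Num (Suc i)) (Lst [Num k, Num m])" "outputs \<tau> (Num k) (Alg R)"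
  shows "outputs R (rule_input (H i) \<rho> m) (Lst (H (Suc i)))"
proof -
  obtain k' m' R' where *: "outputs \<phi> (Num (Suc i)) (Lst [Num k', Num m'])"
    "outputs \<tau> (Num k') (Alg R')" "outputs R' (rule_input (H i) \<rho> m') (Lst (H (Suc i)))"
    using assms(3) unfolding nominal_stages_def by blast
  have km: "k' = k" "m' = m" using outputs_deterministic[OF assms(4) *(1)] by auto
  then have "R' = R" using outputs_deterministic[OF assms(5)] *(2) by blast
  with km * show ?thesis by simp
qed

lemma ex_nominal_stages:
  assumes \<phi>: "pair_enumeration \<phi>" and \<tau>: "library \<tau>" and \<rho>: "algorithmic_sequence \<rho>"
    and \<Gamma>: "hypothesis_list \<Gamma>"
  shows "\<exists>H. nominal_stages \<phi> \<tau> \<rho> \<Gamma> H"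
proof -
  have "\<exists>G'. hypothesis_list G' \<and> (\<exists>k m R. outputs \<phi> (Num (Suc i)) (Lst [Num k, Num m]) \<and>
        outputs \<tau> (Num k) (Alg R) \<and> outputs R (rule_input G \<rho> m) (Lst G'))"
    if G: "hypothesis_list G" for i G
  proof -
    obtain k m where km: "outputs \<phi> (Num (Suc i)) (Lst [Num k, Num m])"
      using \<phi> unfolding pair_enumeration_def by (metis le_add1 plus_1_eq_Suc)
    note pos = pair_enumeration_positive[OF \<phi> km]
    obtain R where R: "outputs \<tau> (Num k) (Alg R)" "rule R"
      using \<tau> pos unfolding library_def by blast
    then show ?thesis using rule_outputs[OF R(2) G \<rho> pos(2)] km by blast
  qed
  \<comment> \<open>The start value enters the invariant through the clause for
    \<open>i = 0\<close>; \<open>hypothesis_list\<close> is part of it because rules are only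
    guaranteed to halt on such lists.\<close>
  then have "\<exists>H. \<forall>i. (hypothesis_list (H i) \<and> (i = 0 \<longrightarrow> H i = \<Gamma>)) \<and> (\<exists>k m R.
        outputs \<phi> (Num (Suc i)) (Lst [Num k, Num m]) \<and> outputs \<tau> (Num k) (Alg R) \<and>
        outputs R (rule_input (H i) \<rho> m) (Lst (H (Suc i))))"
    using \<Gamma>
    by (intro dependent_nat_choice[of "\<lambda>i G. hypothesis_list G \<and> (i = 0 \<longrightarrow> G = \<Gamma>)"
      "\<lambda>i G G'. \<exists>k m R. outputs \<phi> (Num (Suc i)) (Lst [Num k, Num m]) \<and>
        outputs \<tau> (Num k) (Alg R) \<and> outputs R (rule_input G \<rho> m) (Lst G')"]) auto
  then show ?thesis unfolding nominal_stages_def by blast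
qed

context
  fixes \<phi> \<tau> \<rho> \<Gamma> H
  assumes \<phi>: "pair_enumeration \<phi>" and \<tau>: "library \<tau>" and \<rho>: "algorithmic_sequence \<rho>"
    and \<Gamma>: "hypothesis_list \<Gamma>" and H: "nominal_stages \<phi> \<tau> \<rho> \<Gamma> H"
begin

lemma nominal_stages_0: "H 0 = \<Gamma>"
  using H unfolding nominal_stages_def by blast

lemma hypothesis_list_nominal_stages: "hypothesis_list (H i)"
proof (induction i)
  case 0
  show ?case using \<Gamma> nominal_stages_0 by simp
next
  case (Suc i)
  show ?case by (rule nominal_stagesE[OF \<phi> \<tau> H, of i]) (rule rule_extends(2)[OF _ Suc \<rho>])
qed

lemma nominal_stages_mono: "i \<le> j \<Longrightarrow> set (H i) \<subseteq> set (H j)"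
proof (induction rule: dec_induct)
  case (step j)
  have "set (H j) \<subseteq> set (H (Suc j))"
    by (rule nominal_stagesE[OF \<phi> \<tau> H, of j])
      (rule rule_extends(1)[OF _ hypothesis_list_nominal_stages \<rho>])
  with step show ?case by blast
qed simp

lemma nominal_stages_finite_subset:
  assumes "set G \<subseteq> (\<Union>i. set (H i))"
  shows "\<exists>i. set G \<subseteq> set (H i)"
  using assms
proof (induction G)
  case (Cons A G)
  then obtain i j where "A \<in> set (H i)" "set G \<subseteq> set (H j)" by auto
  then show ?case
    using nominal_stages_mono[of i "max i j"] nominal_stages_mono[of j "max i j"]
    by (intro exI[of _ "max i j"]) auto
qed simp

text \<open>A finite \<open>G\<close> lies on a single stage. Since \<open>R\<close> is applied at
  some later stage with a resource at least \<open>m\<close>, monotonicity puts all of its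
  conclusions on the next stage.\<close>

lemma nominal_stages_closed:
  assumes G: "hypothesis_list G" "set G \<subseteq> (\<Union>i. set (H i))" and R: "R \<in> rules_of \<tau>"
    and m: "m \<ge> 1" and C: "outputs R (rule_input G \<rho> m) (Lst C)"
  shows "set C \<subseteq> (\<Union>i. set (H i))"
proof -
  obtain j where j: "set G \<subseteq> set (H j)" using nominal_stages_finite_subset[OF G(2)] by blast
  obtain k where k: "k \<ge> 1" "outputs \<tau> (Num k) (Alg R)" using R by (auto simp: rules_of_def)
  obtain i m' where i: "i \<ge> j" "m' \<ge> m" "outputs \<phi> (Num (Suc i)) (Lst [Num k, Num m'])"
    using pair_enumeration_cofinal[OF \<phi> k(1)] by blast
  have "set G \<subseteq> set (H i)" using j nominal_stages_mono[OF i(1)] by blast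
  then have "set C \<subseteq> set (H (Suc i))"
    using rule_mono[OF library_rule[OF \<tau> R] G(1) hypothesis_list_nominal_stages \<rho> m i(2) _ C
        nominal_stages_step[OF \<phi> \<tau> H i(3) k(2)]] by blast
  then show ?thesis by blast
qed

lemma nominal_stages_sound:
  assumes "\<And>A. A \<in> set \<Gamma> \<Longrightarrow> holds A" "\<And>R. R \<in> rules_of \<tau> \<Longrightarrow> valid_rule \<rho> R"
  shows "A \<in> set (H i) \<Longrightarrow> holds A"
proof (induction i arbitrary: A)
  case 0
  then show ?case using assms(1) nominal_stages_0 by simp
next
  case (Suc i)
  show ?case
    by (rule nominal_stagesE[OF \<phi> \<tau> H, of i])
      (use Suc assms(2) in \<open>unfold valid_rule_def, blast\<close>)
qed

end

section \<open>Truth of deduction statements and soundness of valid libraries\<close>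

lemma holds_entails_iff:
  assumes "deduction_stages \<phi> \<rho> \<Gamma> H"
  shows "holds (entails \<phi> (Alg \<rho>) \<Gamma> B) \<longleftrightarrow> (\<exists>i. B \<in> set (H i))"
  using deduce_correct[OF assms, of B "Num 1"] by (simp add: holds_def entails_def)

lemma algorithmic_statement_entails: "algorithmic_statement (entails \<phi> \<rho> \<Gamma> B)"
  by (simp add: algorithmic_statement_def entails_def)

lemma algorithmic_statement_neg: "algorithmic_statement (neg \<phi> \<rho> A)"
  by (simp add: neg_def implies_def algorithmic_statement_entails)

lemma algorithmic_statement_verum: "algorithmic_statement verum"
  by (simp add: algorithmic_statement_def verum_def)

lemma holds_verum: "holds verum"
  by (simp add: holds_def verum_def)

lemma not_holds_falsum: "\<not> holds falsum"
  by (simp add: holds_def falsum_def)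

lemma valid_library_entails_sound:
  assumes \<phi>: "pair_enumeration \<phi>" and \<rho>: "valid_library \<rho>"
    and \<Gamma>: "hypothesis_list \<Gamma>" "\<And>A. A \<in> set \<Gamma> \<Longrightarrow> holds A"
    and B: "holds (entails \<phi> (Alg \<rho>) \<Gamma> B)"
  shows "holds B"
proof -
  have lib: "library \<rho>" and val: "\<And>R. R \<in> rules_of \<rho> \<Longrightarrow> valid_rule \<rho> R"
    using \<rho> by (auto simp: valid_library_def)
  note seq = library_algorithmic_sequence[OF lib]
  obtain H where H: "nominal_stages \<phi> \<rho> \<rho> \<Gamma> H"
    using ex_nominal_stages[OF \<phi> lib seq \<Gamma>(1)] by blast
  then obtain i where "B \<in> set (H i)"
    using B by (auto simp: holds_entails_iff deduction_stages_nominal)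
  then show ?thesis using nominal_stages_sound[OF \<phi> lib seq \<Gamma>(1) H \<Gamma>(2) val] by blast
qed


section \<open>Libraries with prescribed rules\<close>

text \<open>The rules of \<open>\<sigma>\<close> move up by one index. Two libraries built over the
  same \<open>\<sigma>\<close> therefore differ at index 1 only, which later allows their stages to
  be compared.\<close>

definition cons_library :: "algo \<Rightarrow> algo \<Rightarrow> algo" where
  "cons_library R \<sigma> =
     Cond (test_equal (Basic Ident) (Const (Num 1))) (Const (Alg R)) (Comp \<sigma> (Basic Pred))"

lemma outputs_cons_library:
  "outputs (cons_library R \<sigma>) (Num n) v \<longleftrightarrow>
     (if n = 1 then v = Alg R else outputs \<sigma> (Num (n - 1)) v)"
proof -
  have "outputs (test_equal (Basic Ident) (Const (Num 1))) (Num n) c \<longleftrightarrow>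
      c = Num (if n = 1 then 1 else 0)" for c
    by (subst outputs_test_equal[of _ _ "Num n" _ "Num 1"]) auto
  then show ?thesis by (simp add: cons_library_def outputs_Cond outputs_Comp)
qed

lemma rules_of_cons_library: "rules_of (cons_library R \<sigma>) = insert R (rules_of \<sigma>)"
proof -
  have "S \<in> rules_of (cons_library R \<sigma>)" if S: "S \<in> rules_of \<sigma>" for S
  proof -
    obtain n where "n \<ge> 1" "outputs \<sigma> (Num n) (Alg S)"
      using S by (auto simp: rules_of_def)
    then show ?thesis
      unfolding rules_of_def
      by (intro CollectI exI[of _ "Suc n"]) (simp add: outputs_cons_library)
  qed
  moreover have "R \<in> rules_of (cons_library R \<sigma>)"
    unfolding rules_of_def by (auto simp: outputs_cons_library intro!: exI[of _ 1])
  moreover have "S = R \<or> S \<in> rules_of \<sigma>" if "S \<in> rules_of (cons_library R \<sigma>)" for S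
  proof -
    obtain n where "n \<ge> 1" "outputs (cons_library R \<sigma>) (Num n) (Alg S)"
      using \<open>S \<in> _\<close> by (auto simp: rules_of_def)
    then show ?thesis
      unfolding rules_of_def
      by (cases "n = 1") (auto simp: outputs_cons_library intro!: exI[of _ "n - 1"])
  qed
  ultimately show ?thesis by blast
qed

lemma library_cons_library:
  assumes "rule R" "library \<sigma>"
  shows "library (cons_library R \<sigma>)"
  unfolding library_def
proof (intro allI impI)
  fix n :: nat assume "n \<ge> 1"
  show "\<exists>S. outputs (cons_library R \<sigma>) (Num n) (Alg S) \<and> rule S"
  proof (cases "n = 1")
    case False
    then have "n - 1 \<ge> 1" using \<open>n \<ge> 1\<close> by simp
    then show ?thesis using assms(2) False unfolding library_def outputs_cons_library by auto
  qed (use assms(1) in \<open>simp add: outputs_cons_library\<close>)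
qed

text \<open>\<open>Basic Head\<close> serves as the identity rule: it outputs the hypothesis list.\<close>

lemma rule_Head: "rule (Basic Head)"
  unfolding rule_def by (auto intro: exI[of _ "[]"])

lemma valid_rule_Head: "valid_rule \<rho> (Basic Head)"
  unfolding valid_rule_def by auto

text \<open>A library has a rule at every positive index even if \<open>\<B>\<close> is empty, so a
  constant library of identity rules serves as the tail.\<close>

lemma ex_library_of_finite:
  assumes "finite \<B>" "\<And>R. R \<in> \<B> \<Longrightarrow> rule R"
  shows "\<exists>\<sigma>. library \<sigma> \<and> rules_of \<sigma> = insert (Basic Head) \<B>"
  using assms
proof (induction rule: finite_induct)
  case empty
  have "library (Const (Alg (Basic Head)))" by (simp add: library_def rule_Head)
  moreover have "rules_of (Const (Alg (Basic Head))) = {Basic Head}"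
    by (auto simp: rules_of_def)
  ultimately show ?case by blast
next
  case (insert R \<B>)
  then obtain \<sigma> where "library \<sigma>" "rules_of \<sigma> = Set.insert (Basic Head) \<B>" by auto
  then show ?case
    using insert.prems by (intro exI[of _ "cons_library R \<sigma>"])
      (auto simp: library_cons_library rules_of_cons_library)
qed

lemma ex_library_of_base:
  assumes "base \<B>"
  shows "\<exists>\<sigma>. library \<sigma> \<and> \<B> \<subseteq> rules_of \<sigma> \<and> rules_of \<sigma> \<subseteq> insert (Basic Head) \<B>"
  using assms ex_library_of_finite[of \<B>] unfolding base_def by auto


section \<open>The rule asserting that truth is absurd\<close>

text \<open>This is the body of the loop in \<open>deduce\<close>, except that the rules are fetched
  from the fixed \<open>\<tau>\<close> instead of the nominal library, and a countdown replaces the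
  goal.\<close>

definition simulation_step :: "algo \<Rightarrow> algo \<Rightarrow> algo" where
  "simulation_step \<phi> \<tau> =
     (let next = Comp (Basic Succ) (item 2);
          pair = Comp \<phi> next;
          rule_k = Comp \<tau> (Comp (item 0) pair)
      in tuple [Comp (Basic Pred) (item 0),
           Comp Run (tuple [rule_k, tuple [item 1, item 3, Comp (item 1) pair]]), next, item 3])"

definition neg_verum_prog :: "algo \<Rightarrow> algo" where
  "neg_verum_prog \<phi> = tuple [Const (Alg (deduce \<phi>)),
     tuple [Const (Lst [verum]), item 1, Const falsum], Const (Num 1)]"

text \<open>The states of the loop are \<open>[m - i, H\<^sub>i, i, \<rho>]\<close>.\<close>

definition simulation :: "algo \<Rightarrow> algo \<Rightarrow> algo" where
  "simulation \<phi> \<tau> = Comp (item 1) (Comp (While (item 0) (simulation_step \<phi> \<tau>))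
     (tuple [item 2, tuple [neg_verum_prog \<phi>], Const (Num 0), item 1]))"

text \<open>The resource integer is the number of simulated stages, so the search for
  \<open>falsum\<close> is bounded. Reversing the hypothesis list before
  \<open>rev_append_prog\<close> puts the new statement at its end.\<close>

definition absurdity_rule :: "algo \<Rightarrow> algo \<Rightarrow> algo" where
  "absurdity_rule \<phi> \<tau> =
     Cond (Comp member_prog (tuple [Const falsum, simulation \<phi> \<tau>]))
       (Comp rev_append_prog (tuple
          [Comp rev_append_prog (tuple [item 0, Const (Lst [])]), tuple [neg_verum_prog \<phi>]]))
       (item 0)"

lemma outputs_neg_verum_prog:
  "outputs (neg_verum_prog \<phi>) (rule_input H \<rho> m) (neg \<phi> (Alg \<rho>) verum)"
  by (simp add: neg_verum_prog_def outputs_tuple outputs_item neg_def implies_def entails_def)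

lemma outputs_simulation_step:
  assumes "outputs \<phi> (Num (Suc i)) (Lst [Num k, Num m])" "outputs \<tau> (Num k) (Alg R)"
    and "outputs R (rule_input G \<rho> m) (Lst G')"
  shows "outputs (simulation_step \<phi> \<tau>) (Lst [Num (Suc n), Lst G, Num i, Alg \<rho>])
    (Lst [Num n, Lst G', Num (Suc i), Alg \<rho>])"
proof -
  let ?s = "Lst [Num (Suc n), Lst G, Num i, Alg \<rho>]"
  define nxt where "nxt = Comp (Basic Succ) (item 2)"
  define pair where "pair = Comp \<phi> nxt"
  define rule_k where "rule_k = Comp \<tau> (Comp (item 0) pair)"
  have nxt: "outputs nxt ?s (Num (Suc i))"
    by (simp add: nxt_def outputs_Comp outputs_item)
  have pair: "outputs pair ?s (Lst [Num k, Num m])"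
    unfolding pair_def outputs_Comp using nxt assms(1) by blast
  have pk: "outputs (Comp (item 0) pair) ?s (Num k)" "outputs (Comp (item 1) pair) ?s (Num m)"
    unfolding outputs_Comp using pair
    by (auto intro!: exI[of _ "Lst [Num k, Num m]"] simp: outputs_item)
  have rk: "outputs rule_k ?s (Alg R)"
    unfolding rule_k_def outputs_Comp[of \<tau>] using pk(1) assms(2) by blast
  have "outputs (tuple [rule_k, tuple [item 1, item 3, Comp (item 1) pair]]) ?s
      (Lst [Alg R, rule_input G \<rho> m])"
    using rk pk(2) by (simp add: outputs_tuple outputs_item)
  then have "outputs (Comp Run (tuple [rule_k, tuple [item 1, item 3, Comp (item 1) pair]])) ?s
      (Lst G')"
    unfolding outputs_Comp[of Run] outputs_Run using assms(3) by blast
  moreover have "outputs (Comp (Basic Pred) (item 0)) ?s (Num n)"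
    by (simp add: outputs_Comp outputs_item)
  ultimately have "outputs (tuple [Comp (Basic Pred) (item 0),
      Comp Run (tuple [rule_k, tuple [item 1, item 3, Comp (item 1) pair]]), nxt, item 3]) ?s
      (Lst [Num n, Lst G', Num (Suc i), Alg \<rho>])"
    using nxt by (subst outputs_tuple) (simp add: outputs_item)
  then show ?thesis
    by (simp add: simulation_step_def Let_def nxt_def pair_def rule_k_def)
qed

lemma outputs_simulation:
  assumes G: "nominal_stages \<phi> \<tau> \<rho> [neg \<phi> (Alg \<rho>) verum] G"
  shows "outputs (simulation \<phi> \<tau>) (rule_input H \<rho> m) (Lst (G m))"
proof -
  \<comment> \<open>The countdown itself is the loop test, as \<open>Num 0\<close> means no. The
    start index \<open>i\<close> is kept general because a pass raises it while lowering the
    countdown.\<close>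
  have loop: "outputs (While (item 0) (simulation_step \<phi> \<tau>)) (Lst [Num n, Lst (G i), Num i, Alg \<rho>])
      (Lst [Num 0, Lst (G (i + n)), Num (i + n), Alg \<rho>])" for n i
  proof (induction n arbitrary: i)
    case 0
    show ?case by (subst outputs_While) (simp add: outputs_item)
  next
    case (Suc n)
    obtain k l R where "outputs \<phi> (Num (Suc i)) (Lst [Num k, Num l])"
      "outputs \<tau> (Num k) (Alg R)" "outputs R (rule_input (G i) \<rho> l) (Lst (G (Suc i)))"
      using G unfolding nominal_stages_def by blast
    from outputs_simulation_step[OF this, of n] Suc[of "Suc i"] show ?case
      by (subst outputs_While) (auto simp: outputs_item)
  qed
  have "G 0 = [neg \<phi> (Alg \<rho>) verum]" using G by (simp add: nominal_stages_def)
  then have "outputs (tuple [item 2, tuple [neg_verum_prog \<phi>], Const (Num 0), item 1])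
      (rule_input H \<rho> m) (Lst [Num m, Lst (G 0), Num 0, Alg \<rho>])"
    using outputs_neg_verum_prog by (simp add: outputs_tuple outputs_item)
  then have "outputs (Comp (While (item 0) (simulation_step \<phi> \<tau>))
      (tuple [item 2, tuple [neg_verum_prog \<phi>], Const (Num 0), item 1]))
      (rule_input H \<rho> m) (Lst [Num 0, Lst (G m), Num m, Alg \<rho>])"
    unfolding outputs_Comp[of "While _ _"] using loop[of m 0] by auto
  then show ?thesis
    unfolding simulation_def outputs_Comp[of "item 1"]
    by (intro exI[of _ "Lst [Num 0, Lst (G m), Num m, Alg \<rho>]"]) (simp add: outputs_item)
qed

lemma outputs_absurdity_rule:
  assumes "nominal_stages \<phi> \<tau> \<rho> [neg \<phi> (Alg \<rho>) verum] G"
  shows "outputs (absurdity_rule \<phi> \<tau>) (rule_input H \<rho> m) v \<longleftrightarrow>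
    v = Lst (H @ (if falsum \<in> set (G m) then [neg \<phi> (Alg \<rho>) verum] else []))"
proof -
  let ?u = "rule_input H \<rho> m" and ?D = "neg \<phi> (Alg \<rho>) verum"
  have "outputs (tuple [Const falsum, simulation \<phi> \<tau>]) ?u (Lst [falsum, Lst (G m)])"
    using outputs_simulation[OF assms] by (simp add: outputs_tuple)
  then have test: "outputs (Comp member_prog (tuple [Const falsum, simulation \<phi> \<tau>])) ?u
      (Num (if falsum \<in> set (G m) then 1 else 0))"
    unfolding outputs_Comp using outputs_member_prog by blast
  have "outputs (tuple [item 0, Const (Lst [])]) ?u (Lst [Lst H, Lst []])"
    by (simp add: outputs_tuple outputs_item)
  then have "outputs (Comp rev_append_prog (tuple [item 0, Const (Lst [])])) ?u (Lst (rev H))"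
    unfolding outputs_Comp[of rev_append_prog] using outputs_rev_append_prog[of H "[]"] by auto
  then have "outputs (tuple [Comp rev_append_prog (tuple [item 0, Const (Lst [])]),
      tuple [neg_verum_prog \<phi>]]) ?u (Lst [Lst (rev H), Lst [?D]])"
    using outputs_neg_verum_prog by (simp add: outputs_tuple)
  then have append: "outputs (Comp rev_append_prog (tuple
      [Comp rev_append_prog (tuple [item 0, Const (Lst [])]), tuple [neg_verum_prog \<phi>]])) ?u
      (Lst (H @ [?D]))"
    unfolding outputs_Comp[of rev_append_prog _ ?u]
    using outputs_rev_append_prog[of "rev H" "[?D]"] by auto
  have "outputs (absurdity_rule \<phi> \<tau>) ?u (Lst (H @ (if falsum \<in> set (G m) then [?D] else [])))"
    unfolding absurdity_rule_def outputs_Cond using test append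
    by (intro exI[of _ "Num (if falsum \<in> set (G m) then 1 else 0)"]) (simp add: outputs_item)
  then show ?thesis using outputs_deterministic by blast
qed

text \<open>The rule halts because it only applies genuine rules, those of \<open>\<tau>\<close>,
  finitely often, whatever \<open>\<rho>\<close> is. It is monotone because the stages grow with the
  resource, and because whether it fires does not depend on the hypothesis list.\<close>

lemma rule_absurdity_rule:
  assumes \<phi>: "pair_enumeration \<phi>" and \<tau>: "library \<tau>"
  shows "rule (absurdity_rule \<phi> \<tau>)"
proof -
  have stages: "\<exists>G. nominal_stages \<phi> \<tau> \<rho> [neg \<phi> (Alg \<rho>) verum] G \<and>
      (\<forall>i j. i \<le> j \<longrightarrow> set (G i) \<subseteq> set (G j))"
    if \<rho>: "algorithmic_sequence \<rho>" for \<rho>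
  proof -
    have hyp: "hypothesis_list [neg \<phi> (Alg \<rho>) verum]"
      by (simp add: hypothesis_list_def algorithmic_statement_neg)
    then obtain G where "nominal_stages \<phi> \<tau> \<rho> [neg \<phi> (Alg \<rho>) verum] G"
      using ex_nominal_stages[OF \<phi> \<tau> \<rho>] by blast
    then show ?thesis using nominal_stages_mono[OF \<phi> \<tau> \<rho> hyp] by blast
  qed
  show ?thesis unfolding rule_def
  proof (intro conjI allI impI; (elim conjE)?)
    fix H \<rho> and m :: nat
    assume H: "hypothesis_list H" and \<rho>: "algorithmic_sequence \<rho>"
    obtain G where G: "nominal_stages \<phi> \<tau> \<rho> [neg \<phi> (Alg \<rho>) verum] G"
      using stages[OF \<rho>] by blast
    show "\<exists>C. outputs (absurdity_rule \<phi> \<tau>) (rule_input H \<rho> m) (Lst (H @ C)) \<and>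
        hypothesis_list (H @ C)"
      unfolding outputs_absurdity_rule[OF G]
      using H by (auto simp: hypothesis_list_def algorithmic_statement_neg)
  next
    fix H H' \<rho> C C' and m m' :: nat
    assume \<rho>: "algorithmic_sequence \<rho>" and "m \<le> m'" "set H \<subseteq> set H'"
      and C: "outputs (absurdity_rule \<phi> \<tau>) (rule_input H \<rho> m) (Lst C)"
        "outputs (absurdity_rule \<phi> \<tau>) (rule_input H' \<rho> m') (Lst C')"
    obtain G where G: "nominal_stages \<phi> \<tau> \<rho> [neg \<phi> (Alg \<rho>) verum] G"
      and "set (G m) \<subseteq> set (G m')"
      using stages[OF \<rho>] \<open>m \<le> m'\<close> by blast
    then show "set C \<subseteq> set C'"
      using C \<open>set H \<subseteq> set H'\<close> unfolding outputs_absurdity_rule[OF G] by auto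
  qed
qed

section \<open>The valid library in which the double negation of truth fails\<close>

lemma ex_valid_library_fails_double_neg_verum:
  assumes \<phi>: "pair_enumeration \<phi>" and \<B>: "stable_base \<B>"
  shows "\<exists>\<rho>. base_library \<B> \<rho> \<and> valid_library \<rho> \<and>
    fails (neg \<phi> (Alg \<rho>) (neg \<phi> (Alg \<rho>) verum))"
proof -
  obtain \<sigma> where \<sigma>: "library \<sigma>" "\<B> \<subseteq> rules_of \<sigma>" "rules_of \<sigma> \<subseteq> insert (Basic Head) \<B>"
    using ex_library_of_base \<B> unfolding stable_base_def by blast
  \<comment> \<open>\<open>R\<close> cannot contain \<open>\<rho>\<close>, which is built from
    \<open>R\<close>. The library \<open>\<tau>\<close> stands in for it, with the identity rule at
    the index where \<open>\<rho>\<close> has \<open>R\<close>.\<close>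
  define \<tau> where "\<tau> = cons_library (Basic Head) \<sigma>"
  define R where "R = absurdity_rule \<phi> \<tau>"
  define \<rho> where "\<rho> = cons_library R \<sigma>"
  define D where "D = neg \<phi> (Alg \<rho>) verum"
  have \<tau>: "library \<tau>" unfolding \<tau>_def by (rule library_cons_library[OF rule_Head \<sigma>(1)])
  have "rule R" unfolding R_def by (rule rule_absurdity_rule[OF \<phi> \<tau>])
  then have \<rho>: "library \<rho>" unfolding \<rho>_def by (rule library_cons_library[OF _ \<sigma>(1)])
  note seq = library_algorithmic_sequence[OF \<rho>]
  have rules: "rules_of \<rho> = insert R (rules_of \<sigma>)"
    unfolding \<rho>_def by (rule rules_of_cons_library)
  have bl: "base_library \<B> \<rho>" using \<rho> \<sigma>(2) rules by (auto simp: base_library_def)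
  \<comment> \<open>Outside the base there can only be \<open>R\<close> and the identity rule, so
    stability reduces validity of \<open>\<rho>\<close> to that of \<open>R\<close>.\<close>
  have valid: "valid_library \<rho>" if "valid_rule \<rho> R"
  proof -
    have "valid_outside \<B> \<rho>"
      using that valid_rule_Head \<sigma>(3) rules by (auto simp: valid_outside_def)
    then show ?thesis using \<B> bl unfolding stable_base_def by blast
  qed
  have hypD: "hypothesis_list [D]" and hypT: "hypothesis_list [verum]"
    by (simp_all add: hypothesis_list_def D_def algorithmic_statement_neg
        algorithmic_statement_verum)
  obtain G where G: "nominal_stages \<phi> \<tau> \<rho> [D] G"
    using ex_nominal_stages[OF \<phi> \<tau> seq hypD] by blast
  have out_R: "outputs R (rule_input H \<rho> m) v \<longleftrightarrow>
      v = Lst (H @ (if falsum \<in> set (G m) then [D] else []))" for H m v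
    unfolding R_def D_def by (rule outputs_absurdity_rule[OF G[unfolded D_def]])
  have no_falsum: "falsum \<notin> set (G j)" for j
  proof
    assume j: "falsum \<in> set (G j)"
    obtain H where H: "nominal_stages \<phi> \<rho> \<rho> [verum] H"
      using ex_nominal_stages[OF \<phi> \<rho> seq hypT] by blast
    note closed = nominal_stages_closed[OF \<phi> \<rho> seq hypT H]
    \<comment> \<open>A resource integer must be positive, whereas \<open>j\<close> may be 0. With
      resource \<open>Suc j\<close> the rule \<open>R\<close> then yields \<open>D\<close> even from
      the empty hypothesis list.\<close>
    have "falsum \<in> set (G (Suc j))"
      using j nominal_stages_mono[OF \<phi> \<tau> seq hypD G, of j "Suc j"] by auto
    then have "outputs R (rule_input [] \<rho> (Suc j)) (Lst [D])" by (simp add: out_R)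
    then have D_in: "D \<in> (\<Union>i. set (H i))"
      using closed[of "[]" R "Suc j" "[D]"] rules by (simp add: hypothesis_list_def)
    \<comment> \<open>Once \<open>D\<close> is reached from \<open>verum\<close>, closure carries
      the whole simulated deduction from \<open>D\<close> into the deduction from
      \<open>verum\<close>.\<close>
    have "set (G i) \<subseteq> (\<Union>i. set (H i))" for i
    proof (induction i)
      case 0
      show ?case using D_in nominal_stages_0[OF \<phi> \<tau> seq hypD G] by simp
    next
      case (Suc i)
      obtain k m S where m: "m \<ge> 1" and S: "S \<in> rules_of \<tau>"
        and out: "outputs S (rule_input (G i) \<rho> m) (Lst (G (Suc i)))"
        by (rule nominal_stagesE[OF \<phi> \<tau> G, of i])
      \<comment> \<open>The identity rule in \<open>\<tau>\<close> need not be a rule of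
        \<open>\<rho>\<close>, so it gets its own case.\<close>
      consider "S = Basic Head" | "S \<in> rules_of \<rho>"
        using S rules unfolding \<tau>_def rules_of_cons_library by blast
      then show ?case
      proof cases
        case 1
        then show ?thesis using out Suc by simp
      next
        case 2
        show ?thesis
          by (rule closed[OF hypothesis_list_nominal_stages[OF \<phi> \<tau> seq hypD G] Suc 2 m out])
      qed
    qed
    then have F: "holds D"
      unfolding D_def neg_def implies_def
      using j H by (subst holds_entails_iff[of _ _ _ H]) (auto simp: deduction_stages_nominal)
    \<comment> \<open>The only statement that \<open>R\<close> can add is \<open>D\<close>, which is
      now known to be true.\<close>
    then have "valid_rule \<rho> R" unfolding valid_rule_def by (auto simp: out_R)
    then have "holds falsum"
      using valid_library_entails_sound[OF \<phi> valid hypT] F holds_verum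
      unfolding D_def neg_def implies_def by simp
    then show False using not_holds_falsum by simp
  qed
  then have out_R: "outputs R (rule_input H \<rho> m) v \<longleftrightarrow> v = Lst H" for H m v
    by (simp add: out_R)
  have "valid_rule \<rho> R" unfolding valid_rule_def by (simp add: out_R)
  \<comment> \<open>As \<open>R\<close> never fires, it acts like the identity rule at index 1, and
    all other indices agree. Hence \<open>deduce\<close> with library \<open>\<rho>\<close> runs
    through exactly the simulated stages, none of which contains \<open>falsum\<close>.\<close>
  moreover have "deduction_stages \<phi> \<rho> [D] G"
    unfolding deduction_stages_nominal nominal_stages_def
  proof (intro conjI allI)
    show "G 0 = [D]" by (rule nominal_stages_0[OF \<phi> \<tau> seq hypD G])
    fix i
    obtain k m S where *: "outputs \<phi> (Num (Suc i)) (Lst [Num k, Num m])"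
      "outputs \<tau> (Num k) (Alg S)" "outputs S (rule_input (G i) \<rho> m) (Lst (G (Suc i)))"
      by (rule nominal_stagesE[OF \<phi> \<tau> G, of i])
    show "\<exists>k m S. outputs \<phi> (Num (Suc i)) (Lst [Num k, Num m]) \<and> outputs \<rho> (Num k) (Alg S) \<and>
        outputs S (rule_input (G i) \<rho> m) (Lst (G (Suc i)))"
    proof (cases "k = 1")
      case True
      then have "S = Basic Head" using *(2) by (simp add: \<tau>_def outputs_cons_library)
      then have "G (Suc i) = G i" using *(3) by simp
      then show ?thesis using *(1) True
        by (intro exI[of _ 1] exI[of _ m] exI[of _ R])
          (simp add: \<rho>_def[symmetric] out_R, simp add: \<rho>_def outputs_cons_library)
    next
      case False
      then have "outputs \<rho> (Num k) (Alg S)"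
        using *(2) by (simp add: \<rho>_def \<tau>_def outputs_cons_library)
      with * show ?thesis by blast
    qed
  qed
  ultimately show ?thesis
    using bl valid no_falsum holds_entails_iff[of \<phi> \<rho> "[D]" G falsum]
    by (intro exI[of _ \<rho>])
      (simp add: fails_def algorithmic_statement_neg D_def[symmetric],
        simp add: neg_def implies_def)
qed

theorem proposition14p13:
  fixes \<phi> :: algo and \<B> :: "algo set"
  assumes "pair_enumeration \<phi>"
    and "stable_base \<B>"
  shows "(\<exists>\<rho>. base_library \<B> \<rho> \<and> valid_library \<rho> \<and>
            fails (neg \<phi> (Alg \<rho>) (neg \<phi> (Alg \<rho>) verum))) \<and>
         \<not> (\<forall>\<rho>. base_library \<B> \<rho> \<longrightarrow>
               (\<forall>A. algorithmic_statement A \<longrightarrow>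
                  holds (entails \<phi> (Alg \<rho>) [A] (neg \<phi> (Alg \<rho>) (neg \<phi> (Alg \<rho>) A))))) \<and>
         (\<forall>P. implements_diagram P (double_neg_diagram \<phi>) \<longrightarrow> P \<notin> \<B>)"
proof -
  obtain \<rho> where \<rho>: "base_library \<B> \<rho>" "valid_library \<rho>"
    and fails: "fails (neg \<phi> (Alg \<rho>) (neg \<phi> (Alg \<rho>) verum))" (is "fails ?N")
    using ex_valid_library_fails_double_neg_verum[OF assms] by blast
  have N: "\<not> holds ?N" using fails by (simp add: fails_def)
  have hyp: "hypothesis_list [verum]"
    by (simp add: hypothesis_list_def algorithmic_statement_verum)
  \<comment> \<open>The same library refutes the law at \<open>verum\<close>: soundness would turn
    the deduction into the truth of \<open>?N\<close>.\<close>
  have "\<not> holds (entails \<phi> (Alg \<rho>) [verum] ?N)"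
    using valid_library_entails_sound[OF assms(1) \<rho>(2) hyp] holds_verum N by auto
  moreover have "P \<notin> \<B>" if P: "implements_diagram P (double_neg_diagram \<phi>)" for P
  proof
    \<comment> \<open>A rule of the base belongs to the valid library \<open>\<rho>\<close>, so it
      may not lead from the true \<open>verum\<close> to the false \<open>?N\<close>; its instance
      for \<open>verum\<close> does exactly that.\<close>
    assume "P \<in> \<B>"
    then have valid: "valid_rule \<rho> P"
      using \<rho> by (auto simp: base_library_def valid_library_def)
    have "algorithmic_sequence \<rho>"
      using \<rho>(2) library_algorithmic_sequence by (simp add: valid_library_def)
    then obtain C where C: "outputs P (rule_input [verum] \<rho> 1) (Lst ([verum] @ C))"
      "set C = {Y. \<exists>Xs. (Xs, Y) \<in> double_neg_diagram \<phi> \<rho> \<and> set Xs \<subseteq> set [verum]}"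
      using P hyp unfolding implements_diagram_def by blast
    have "?N \<in> set C"
      unfolding C(2) double_neg_diagram_def using algorithmic_statement_verum by force
    moreover have "\<forall>A\<in>set ([verum] @ C). holds A"
      using valid C(1) holds_verum unfolding valid_rule_def
      by (metis empty_iff empty_set le_refl set_ConsD)
    ultimately show False using N by simp
  qed
  ultimately show ?thesis using \<rho> fails algorithmic_statement_verum by blast
qed

end
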